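(* Let $\mathcal{C}$ be a $\mathbb{Z}_5\mathbb{Z}_{25}$-additive code of type $(\alpha,\beta;\gamma,\delta;\kappa)$, where $\alpha,\beta,\gamma,\delta,\kappa\ge 0$, $\alpha+\beta>0$, $0<\delta+\gamma\le\beta+\kappa$ and $\kappa\le\min(\alpha,\gamma)$, and let $C=\Phi(\mathcal{C})$ be the corresponding $\mathbb{Z}_5\mathbb{Z}_{25}$-linear code of length $n=\alpha+5\beta$. Then: (i) Let $\mathcal{G}$ be a generator matrix of $\mathcal{C}$, and let $\{\mathbf{u}_i\}_{i=1}^{\gamma}$ and $\{\mathbf{v}_j\}_{j=1}^{\delta}$ be the rows of $\mathcal{G}$ of order $5$ and of order $25$, respectively. Then $\langle C\rangle$ is generated (as a $\mathbb{Z}_5$-vector space) by $\{\Phi(\mathbf{u}_i)\}_{i=1}^{\gamma}$, $\{\Phi(\mathbf{v}_j)\}_{j=1}^{\delta}$, $\{\Phi(5\,\mathbf{v}_{i_1}*\mathbf{v}_{i_2}*\mathbf{v}_{i_3})\}_{1\le i_1\le i_2\le i_3\le\delta}$, $\{\Phi(5\,\mathbf{v}_{i_1}*\cdots*\mathbf{v}_{i_4})\}_{1\le i_1\le\cdots\le i_4\le\delta}$ and $\{\Phi(5\,\mathbf{v}_{i_1}*\cdots*\mathbf{v}_{i_5})\}_{1\le i_1\le\cdots\le i_5\le\delta}$. (ii) $rank(C)\in\left\{\gamma+2\delta,\ldots,\min\left(\beta+\delta+\kappa,\ \gamma+\delta+\binom{\delta+2}{3}+\binom{\delta+3}{4}+\binom{\delta+4}{5}\right)\right\}$.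 Equivalently, writing $rank(C)=\gamma+2\delta+\overline{r}$, one has $\overline{r}\in\left\{0,1,\ldots,\min\left(\beta-(\gamma-\kappa)-\delta,\ \binom{\delta+2}{3}+\binom{\delta+3}{4}+\binom{\delta+4}{5}-\delta\right)\right\}$. (iii) The linear code $\langle C\rangle$ over $\mathbb{Z}_5$ is $\mathbb{Z}_5\mathbb{Z}_{25}$-linear.
   Context: A $\mathbb{Z}_5\mathbb{Z}_{25}$-additive code is a subgroup $\mathcal{C}$ of $\mathbb{Z}_5^\alpha\times\mathbb{Z}_{25}^\beta$. The Gray map $\phi:\mathbb{Z}_{25}\to\mathbb{Z}_5^5$ is $\phi(u)=(u_1,u_1,u_1,u_1,u_1)+u_0\,Y$, where $u=u_0+5u_1$ with $u_0,u_1\in\{0,\ldots,4\}$ and $Y$ is a fixed row vector listing all distinct elements of $\mathbb{Z}_5$, e.g. $Y=(0,1,2,3,4)$. Its extension $\Phi:\mathbb{Z}_5^\alpha\times\mathbb{Z}_{25}^\beta\to\mathbb{Z}_5^{n}$, $n=\alpha+5\beta$, is $\Phi(\mathbf{x},\mathbf{y})=(\mathbf{x},\phi(y_1),\ldots,\phi(y_\beta))$. A code is called $\mathbb{Z}_5\mathbb{Z}_{25}$-linear if it equals $\Phi(\mathcal{C})$ for some $\mathbb{Z}_5\mathbb{Z}_{25}$-additive code $\mathcal{C}$. The additive code $\mathcal{C}$ (and $C=\Phi(\mathcal{C})$) is of type $(\alpha,\beta;\gamma,\delta;\kappa)$ if $\mathcal{C}\subseteq\mathbb{Z}_5^\alpha\times\mathbb{Z}_{25}^\beta$,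 $\mathcal{C}\cong\mathbb{Z}_5^\gamma\times\mathbb{Z}_{25}^\delta$ as a group, and $\kappa$ is the dimension over $\mathbb{Z}_5$ of the projection onto the first $\alpha$ (i.e. the $\mathbb{Z}_5$-) coordinates of the subcode $\{\mathbf{c}\in\mathcal{C}: 5\mathbf{c}=\mathbf{0}\}$ ($\kappa=0$ if $\alpha=0$). A generator matrix of $\mathcal{C}$ has as rows $\gamma$ codewords $\mathbf{u}_1,\ldots,\mathbf{u}_\gamma$ of order $5$ and $\delta$ codewords $\mathbf{v}_1,\ldots,\mathbf{v}_\delta$ of order $25$ such that every $\mathbf{c}\in\mathcal{C}$ is uniquely of the form $\sum_i\lambda_i\mathbf{u}_i+\sum_j\nu_j\mathbf{v}_j$ with $\lambda_i\in\mathbb{Z}_5$, $\nu_j\in\mathbb{Z}_{25}$. For $\mathbf{u},\mathbf{v}\in\mathbb{Z}_5^\alpha\times\mathbb{Z}_{25}^\beta$, $\mathbf{u}*\mathbf{v}$ denotes the componentwise product. $\langle C\rangle$ is the $\mathbb{Z}_5$-linear span of $C$, and $rank(C)=\dim\langle C\rangle$. The notation $\{a,\ldots,b\}$ denotes the set of integers $x$ with $a\le x\le b$. *)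

theory Defs
  imports
    "HOL-Library.Numeral_Type"
    "HOL-Algebra.Multiplicative_Group"
    "Jordan_Normal_Form.VS_Connect"
    "Berlekamp_Zassenhaus.Finite_Field"
begin

text \<open>
  \<open>'a mod_ring\<close> is the ring of integers modulo \<open>CARD('a)\<close>, and it is a field when \<open>'a\<close> is of class
  \<open>prime_card\<close>. That class cannot be established for the numeral type \<open>5\<close>, which is a compound type
  expression, so the five-element enumeration type serves as the index of the prime field.
\<close>

instance Enum.finite_5 :: prime_card
proof
  have "CARD(Enum.finite_5) = 5"
    by (simp add: UNIV_finite_5)
  then show "prime CARD(Enum.finite_5)"
    by simp
qed

instance bit1 :: (finite) nontriv
proof
  show "CARD('a bit1) > 1"
    using zero_less_card_finite[where 'a = 'a] by simp
qed

type_synonym Z5 = "Enum.finite_5 mod_ring"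
type_synonym Z25 = "25 mod_ring"
type_synonym mixed_vec = "Z5 vec \<times> Z25 vec"


text \<open>
  \<open>HOL-Algebra\<close> groups are written multiplicatively: in \<open>mixed_group \<alpha> \<beta>\<close> the operation \<open>\<otimes>\<close> is
  componentwise addition and the power \<open>c [^] k\<close> is the multiple \<open>k c\<close>.
\<close>

definition mixed_group :: "nat \<Rightarrow> nat \<Rightarrow> mixed_vec monoid" where
  "mixed_group \<alpha> \<beta> = monoid_vec TYPE(Z5) \<alpha> \<times>\<times> monoid_vec TYPE(Z25) \<beta>"

definition additive_code :: "nat \<Rightarrow> nat \<Rightarrow> mixed_vec set \<Rightarrow> bool" where
  "additive_code \<alpha> \<beta> \<C> \<longleftrightarrow> subgroup \<C> (mixed_group \<alpha> \<beta>)"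

definition mixed_prod :: "mixed_vec \<Rightarrow> mixed_vec \<Rightarrow> mixed_vec"  (infixl \<open>\<star>\<close> 70) where
  "u \<star> v =
    (vec (dim_vec (fst u)) (\<lambda>i. fst u $ i * fst v $ i),
     vec (dim_vec (snd u)) (\<lambda>j. snd u $ j * snd v $ j))"


definition gray :: "Z5 vec \<Rightarrow> Z25 \<Rightarrow> Z5 vec" where
  "gray Y u =
    (let u0 = to_int_mod_ring u mod 5; u1 = to_int_mod_ring u div 5
     in of_int u1 \<cdot>\<^sub>v vec 5 (\<lambda>_. 1) + of_int u0 \<cdot>\<^sub>v Y)"

definition Gray :: "Z5 vec \<Rightarrow> mixed_vec \<Rightarrow> Z5 vec" where
  "Gray Y c =
    fst c @\<^sub>v vec_of_list (concat (map (\<lambda>u. list_of_vec (gray Y u)) (list_of_vec (snd c))))"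

text \<open>
  \<open>\<alpha>\<close> and \<open>\<beta>\<close> are parameters here: if they could be chosen freely subject to \<open>\<alpha> + 5 * \<beta> = n\<close>,
  every linear code would qualify through \<open>\<beta> = 0\<close>.
\<close>

definition mixed_linear :: "Z5 vec \<Rightarrow> nat \<Rightarrow> nat \<Rightarrow> Z5 vec set \<Rightarrow> bool" where
  "mixed_linear Y \<alpha> \<beta> C \<longleftrightarrow> (\<exists>\<D>. additive_code \<alpha> \<beta> \<D> \<and> C = Gray Y ` \<D>)"


definition lin_span :: "nat \<Rightarrow> Z5 vec set \<Rightarrow> Z5 vec set" where
  "lin_span n S = LinearCombinations.module.span class_ring (module_vec TYPE(Z5) n) S"

definition lin_dim :: "nat \<Rightarrow> Z5 vec set \<Rightarrow> nat" where
  "lin_dim n W = vectorspace.dim class_ring ((module_vec TYPE(Z5) n)\<lparr>carrier := W\<rparr>)"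

definition code_rank :: "nat \<Rightarrow> Z5 vec set \<Rightarrow> nat" where
  "code_rank n C = lin_dim n (lin_span n C)"


definition code_of_type ::
    "nat \<Rightarrow> nat \<Rightarrow> nat \<Rightarrow> nat \<Rightarrow> nat \<Rightarrow> mixed_vec set \<Rightarrow> bool" where
  "code_of_type \<alpha> \<beta> \<gamma> \<delta> \<kappa> \<C> \<longleftrightarrow>
    additive_code \<alpha> \<beta> \<C> \<and>
    (mixed_group \<alpha> \<beta>)\<lparr>carrier := \<C>\<rparr> \<cong> mixed_group \<gamma> \<delta> \<and>
    \<kappa> = lin_dim \<alpha>
      (fst ` {c \<in> \<C>. c [^]\<^bsub>mixed_group \<alpha> \<beta>\<^esub> (5::nat) = \<one>\<^bsub>mixed_group \<alpha> \<beta>\<^esub>})"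

text \<open>
  A coefficient vector \<open>(\<lambda>, \<nu>)\<close> is an element of \<open>mixed_group \<gamma> \<delta>\<close>; the residues \<open>\<lambda>\<^sub>i\<close> and \<open>\<nu>\<^sub>j\<close>
  act through their representatives in \<open>{0..4}\<close> and \<open>{0..24}\<close>.
\<close>

definition row_combination ::
    "nat \<Rightarrow> nat \<Rightarrow> mixed_vec list \<Rightarrow> mixed_vec list \<Rightarrow> mixed_vec \<Rightarrow> mixed_vec" where
  "row_combination \<alpha> \<beta> us vs w =
    (let G = mixed_group \<alpha> \<beta> in
      (\<Otimes>\<^bsub>G\<^esub>i\<in>{..<length us}. us ! i [^]\<^bsub>G\<^esub> to_int_mod_ring (fst w $ i)) \<otimes>\<^bsub>G\<^esub>
      (\<Otimes>\<^bsub>G\<^esub>j\<in>{..<length vs}. vs ! j [^]\<^bsub>G\<^esub> to_int_mod_ring (snd w $ j)))"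

definition generator_matrix ::
    "nat \<Rightarrow> nat \<Rightarrow> nat \<Rightarrow> nat \<Rightarrow> mixed_vec set \<Rightarrow> mixed_vec list \<Rightarrow> mixed_vec list \<Rightarrow> bool" where
  "generator_matrix \<alpha> \<beta> \<gamma> \<delta> \<C> us vs \<longleftrightarrow>
    length us = \<gamma> \<and> length vs = \<delta> \<and>
    (\<forall>u\<in>set us. u \<in> \<C> \<and> group.ord (mixed_group \<alpha> \<beta>) u = 5) \<and>
    (\<forall>v\<in>set vs. v \<in> \<C> \<and> group.ord (mixed_group \<alpha> \<beta>) v = 25) \<and>
    (\<forall>c\<in>\<C>. \<exists>!w. w \<in> carrier (mixed_group \<gamma> \<delta>) \<and> c = row_combination \<alpha> \<beta> us vs w)"

end

theory Submission
  imports Defs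
begin

text \<open>
  Write \<open>u = u\<^sub>0 + 5 u\<^sub>1\<close>. The Gray map is linear in the digits \<open>(u\<^sub>0, u\<^sub>1)\<close>, so its failure to be
  additive is exactly the carry: \<open>\<Phi>(c + d) = \<Phi>(c) + \<Phi>(d) + \<Phi>(5 P(c, d))\<close>, where \<open>P\<close> is a polynomial
  over \<open>\<int>\<^sub>5\<close> with monomials of degrees 3, 4 and 5 only. Hence the span \<open>S\<close> of the Gray image lies in
  the span of \<open>\<Phi>(c)\<close> and \<open>\<Phi>(5 c\<^sub>1 * \<dots> * c\<^sub>k)\<close>, \<open>k = 3, 4, 5\<close>. Conversely, scaling the arguments of \<open>P\<close>
  isolates \<open>x y\<^sup>2\<close>, \<open>x y\<^sup>3\<close> and \<open>x y\<^sup>4\<close>, and polarization yields all products of 3, 4 and 5 codewords.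
  So \<open>S = \<Phi>(\<D>)\<close> for the subgroup \<open>\<D>\<close> generated by the code and these multiples of 5. The bounds on
  the rank follow by comparing \<open>5 ^ rank = |S|\<close> with \<open>|\<C>|\<close>, with the number of generators, and with
  the number of pairs consisting of a residue modulo 5 of the code and an element of \<open>\<D>\<close> of order
  dividing 5.
\<close>

section \<open>Digits and carries\<close>

lemma card_5 [simp]: "CARD(Enum.finite_5) = 5"
  by (simp add: UNIV_finite_5)

text \<open>\<open>lo\<close> and \<open>hi\<close> are the two base-5 digits, read in Z5. Reduction
  modulo 5 makes \<open>lo\<close> a ring homomorphism, whereas \<open>hi\<close> is additive only
  up to a carry.\<close>

definition lo :: "Z25 \<Rightarrow> Z5" where
  "lo u = of_int (to_int_mod_ring u mod 5)"

definition hi :: "Z25 \<Rightarrow> Z5" where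
  "hi u = of_int (to_int_mod_ring u div 5)"

definition digits :: "Z5 \<Rightarrow> Z5 \<Rightarrow> Z25" where
  "digits l h = of_int (to_int_mod_ring l + 5 * to_int_mod_ring h)"

definition carry :: "Z5 \<Rightarrow> Z5 \<Rightarrow> Z5" where
  "carry x y = of_int ((to_int_mod_ring x + to_int_mod_ring y) div 5)"

lemma to_int_of_int [simp]:
  "to_int_mod_ring (of_int a :: 'a::nontriv mod_ring) = a mod int CARD('a)"
  by (transfer) simp

lemma to_int_bounds:
  "0 \<le> to_int_mod_ring (x :: 'a::finite mod_ring)"
  "to_int_mod_ring (x :: 'a::finite mod_ring) < int CARD('a)"
  using range_to_int_mod_ring[where 'a = 'a] by (metis atLeastLessThan_iff rangeI)+

lemma of_int_to_int [simp]: "of_int (to_int_mod_ring x) = (x :: 'a::nontriv mod_ring)"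
  by (simp add: of_int_of_int_mod_ring)

lemma of_int_eq_iff_mod:
  "(of_int a :: 'a::nontriv mod_ring) = of_int b \<longleftrightarrow> a mod int CARD('a) = b mod int CARD('a)"
  by transfer simp

lemma Z5_eqI:
  "a mod 5 = b mod 5 \<Longrightarrow> (of_int a :: Z5) = of_int b"
  by (simp add: of_int_eq_iff_mod)

lemma Z5_bounds: "0 \<le> to_int_mod_ring (x :: Z5)" "to_int_mod_ring (x :: Z5) < 5"
  using to_int_bounds[of x] by simp_all

lemma Z25_bounds: "0 \<le> to_int_mod_ring (x :: Z25)" "to_int_mod_ring (x :: Z25) < 25"
  using to_int_bounds[of x] by simp_all

lemma numeral_5_Z5 [simp]: "(5 :: Z5) = 0"
  using Z5_eqI[of 5 0] by simp

lemma Z5_6: "(6 :: Z5) = 1"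
  using Z5_eqI[of 6 1] by simp

lemma Z5_96: "(96 :: Z5) = 1"
  using Z5_eqI[of 96 1] by simp

lemma Z5_4: "(4 :: Z5) = -1"
  using Z5_eqI[of 4 "-1"] by simp

lemma to_int_Z5_mem: "to_int_mod_ring (x :: Z5) \<in> {0, 1, 2, 3, 4}"
proof -
  have "a \<in> {0, 1, 2, 3, 4}" if "0 \<le> a" "a < 5" for a :: int
    using that by auto
  then show ?thesis
    using Z5_bounds .
qed

lemma lo_of_int [simp]: "lo (of_int a) = of_int a"
proof -
  have "(a mod 25) mod 5 = a mod 5"
    by (simp add: mod_mod_cancel)
  then show ?thesis
    unfolding lo_def by (intro Z5_eqI) simp
qed

text \<open>The high digit can be read off any integer representative: changing a by 25 changes a
  div 5 by 5, which is 0 in Z5. Sums can thus be treated before reduction modulo 25.\<close>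

lemma hi_of_int: "hi (of_int a) = of_int (a div 5)"
proof -
  have "a mod 25 div 5 mod 5 = a div 5 mod 5"
    using zmod_zmult2_eq[of 5 a 5] by simp
  then show ?thesis
    unfolding hi_def by (intro Z5_eqI) simp
qed

lemma lo_add [simp]: "lo (u + v) = lo u + lo v"
  using lo_of_int[of "to_int_mod_ring u + to_int_mod_ring v"]
    lo_of_int[of "to_int_mod_ring u"] lo_of_int[of "to_int_mod_ring v"]
  by simp

lemma lo_mult [simp]: "lo (u * v) = lo u * lo v"
  using lo_of_int[of "to_int_mod_ring u * to_int_mod_ring v"]
    lo_of_int[of "to_int_mod_ring u"] lo_of_int[of "to_int_mod_ring v"]
  by simp

lemma lo_0 [simp]: "lo 0 = 0"
  by (simp add: lo_def)

lemma hi_0 [simp]: "hi 0 = 0"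
  by (simp add: hi_def)

lemma to_int_lo: "to_int_mod_ring (lo u) = to_int_mod_ring u mod 5"
  by (simp add: lo_def)

text \<open>Addition in base 5: the correction depends on the low digits alone. It is the cocycle
  that describes Z25 as an extension of Z5 by Z5.\<close>

lemma hi_add: "hi (u + v) = hi u + hi v + carry (lo u) (lo v)"
proof -
  define a b where "a = to_int_mod_ring u" and "b = to_int_mod_ring v"
  have "hi (u + v) = of_int ((a + b) div 5)"
    using hi_of_int[of "a + b"] by (simp add: a_def b_def)
  also have "(a + b) div 5 = a div 5 + b div 5 + (a mod 5 + b mod 5) div 5"
    by (rule div_add1_eq)
  finally show ?thesis
    by (simp add: hi_def carry_def to_int_lo a_def b_def)
qed

lemma lo_digits [simp]: "lo (digits l h) = l"
proof -
  have "(of_int (to_int_mod_ring l + 5 * to_int_mod_ring h) :: Z5) = of_int (to_int_mod_ring l)"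
    by (intro Z5_eqI) simp
  then show ?thesis
    unfolding digits_def lo_of_int by simp
qed

lemma hi_digits [simp]: "hi (digits l h) = h"
  unfolding digits_def hi_of_int using Z5_bounds[of l] by simp

lemma Z25_eqI:
  assumes "lo u = lo v" and "hi u = hi v"
  shows "u = v"
proof -
  let ?a = "to_int_mod_ring u" and ?b = "to_int_mod_ring v"
  have "?a mod 5 = ?b mod 5" "?a div 5 mod 5 = ?b div 5 mod 5"
    using assms unfolding lo_def hi_def of_int_eq_iff_mod by simp_all
  moreover have "?a div 5 mod 5 = ?a div 5" "?b div 5 mod 5 = ?b div 5"
    using Z25_bounds[of u] Z25_bounds[of v] by simp_all
  ultimately have "?a = ?b"
    by (metis mult_div_mod_eq)
  then show ?thesis
    using to_int_mod_ring_hom.injectivity by blast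
qed

lemma lo_5 [simp]: "lo 5 = 0"
  using lo_of_int[of 5] by simp

lemma hi_5_mult [simp]: "hi (5 * u) = lo u"
  using hi_of_int[of "5 * to_int_mod_ring u"] lo_of_int[of "to_int_mod_ring u"] by simp

lemma carry_0 [simp]: "carry x 0 = 0" "carry 0 x = 0"
  using Z5_bounds[of x] by (simp_all add: carry_def)

text \<open>Since \<open>carry x y = (x + y choose 5)\<close> modulo 5, Vandermonde's identity gives a polynomial; its
  part of degree 2 vanishes modulo 5.\<close>

lemma carry_polynomial:
  "carry x y = 4 * (x * y * y) + 4 * (x * x * y) + 3 * (x * y * y * y) + 2 * (x * x * y * y)
    + 3 * (x * x * x * y) + 4 * (x * y * y * y * y) + 3 * (x * x * y * y * y)
    + 3 * (x * x * x * y * y) + 4 * (x * x * x * x * y)"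
proof -
  have "\<forall>a\<in>{0, 1, 2, 3, 4 :: int}. \<forall>b\<in>{0, 1, 2, 3, 4 :: int}.
    ((a + b) div 5) mod 5 = (4 * (a * b * b) + 4 * (a * a * b) + 3 * (a * b * b * b)
    + 2 * (a * a * b * b) + 3 * (a * a * a * b) + 4 * (a * b * b * b * b)
    + 3 * (a * a * b * b * b) + 3 * (a * a * a * b * b) + 4 * (a * a * a * a * b)) mod 5"
    by simp
  note bspec[OF bspec[OF this to_int_Z5_mem[of x]] to_int_Z5_mem[of y]]
  from Z5_eqI[OF this] show ?thesis
    by (simp add: carry_def)
qed

text \<open>Moves a carry of scaled arguments to the integers, where identities between carries can
  be checked on the 25 pairs of representatives.\<close>

lemma carry_scaled:
  "carry (of_int l * x) (of_int m * y) =
    of_int (((l * to_int_mod_ring x) mod 5 + (m * to_int_mod_ring y) mod 5) div 5)"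
  using to_int_of_int[where 'a = Enum.finite_5, of "l * to_int_mod_ring x"]
    to_int_of_int[where 'a = Enum.finite_5, of "m * to_int_mod_ring y"]
  by (simp add: carry_def)

text \<open>The coefficients solve a linear system over \<open>\<int>\<^sub>5\<close>: the homogeneous components of the carry
  polynomial are separated by scaling \<open>x\<close> and \<open>y\<close> independently.\<close>

lemma monomials_from_carry:
  "x * y * y = 3 * carry x y + carry x (2 * y) + 4 * carry (2 * x) (2 * y)
    + 3 * carry (2 * x) (4 * y) + carry (3 * x) y + 3 * carry (3 * x) (3 * y)" (is ?thesis3)
  "x * y * y * y = 2 * carry x y + 3 * carry x (2 * y) + 4 * carry x (3 * y)
    + 3 * carry (2 * x) y + 4 * carry (2 * x) (2 * y) + carry (2 * x) (4 * y)" (is ?thesis4)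
  "x * y * y * y * y = carry x y + carry x (2 * y) + carry x (3 * y) + carry x (4 * y)" (is ?thesis5)
proof -
  define p :: "int \<Rightarrow> int \<Rightarrow> int \<Rightarrow> int \<Rightarrow> int"
    where "p a b l m = ((l * a) mod 5 + (m * b) mod 5) div 5" for a b l m
  have carry: "carry (of_int l * x) (of_int m * y) =
      of_int (p (to_int_mod_ring x) (to_int_mod_ring y) l m)" for l m
    by (simp only: carry_scaled p_def)
  note c = carry[of 1 1, simplified] carry[of 1 2, simplified] carry[of 1 3, simplified]
    carry[of 1 4, simplified] carry[of 2 1, simplified] carry[of 2 2, simplified]
    carry[of 2 4, simplified] carry[of 3 1, simplified] carry[of 3 3, simplified]
  have "\<forall>a\<in>{0, 1, 2, 3, 4}. \<forall>b\<in>{0, 1, 2, 3, 4}. (a * b * b) mod 5 =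
      (3 * p a b 1 1 + p a b 1 2 + 4 * p a b 2 2 + 3 * p a b 2 4 + p a b 3 1 + 3 * p a b 3 3) mod 5"
    unfolding ball_simps p_def by simp
  note bspec[OF bspec[OF this to_int_Z5_mem[of x]] to_int_Z5_mem[of y]]
  from Z5_eqI[OF this] show ?thesis3
    by (simp add: c)
  have "\<forall>a\<in>{0, 1, 2, 3, 4}. \<forall>b\<in>{0, 1, 2, 3, 4}. (a * b * b * b) mod 5 =
      (2 * p a b 1 1 + 3 * p a b 1 2 + 4 * p a b 1 3 + 3 * p a b 2 1 + 4 * p a b 2 2 + p a b 2 4) mod 5"
    unfolding ball_simps p_def by simp
  note bspec[OF bspec[OF this to_int_Z5_mem[of x]] to_int_Z5_mem[of y]]
  from Z5_eqI[OF this] show ?thesis4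
    by (simp add: c)
  have "\<forall>a\<in>{0, 1, 2, 3, 4}. \<forall>b\<in>{0, 1, 2, 3, 4}. (a * b * b * b * b) mod 5 =
      (p a b 1 1 + p a b 1 2 + p a b 1 3 + p a b 1 4) mod 5"
    unfolding ball_simps p_def by simp
  note bspec[OF bspec[OF this to_int_Z5_mem[of x]] to_int_Z5_mem[of y]]
  from Z5_eqI[OF this] show ?thesis5
    by (simp add: c)
qed

section \<open>Subspaces of vector spaces over the prime field\<close>

text \<open>Over the integers modulo m every scalar is a sum of ones, so closure under addition
  gives closure under scalars (\<open>additive_set_smult\<close>), and over Z5 such a set is a
  subspace. The general element type lets the notion serve for Z25 vectors as well.\<close>

definition additive_set :: "nat \<Rightarrow> 'a::monoid_add vec set \<Rightarrow> bool" where
  "additive_set n W \<longleftrightarrow>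
    W \<subseteq> carrier_vec n \<and> 0\<^sub>v n \<in> W \<and> (\<forall>x\<in>W. \<forall>y\<in>W. x + y \<in> W)"

lemma additive_setD:
  assumes "additive_set n W"
  shows "W \<subseteq> carrier_vec n" and "0\<^sub>v n \<in> W" and "x \<in> W \<Longrightarrow> y \<in> W \<Longrightarrow> x + y \<in> W"
  using assms by (auto simp: additive_set_def)

lemma finite_carrier_vec [simp]: "finite (carrier_vec n :: 'a::finite vec set)"
proof (rule finite_subset)
  show "carrier_vec n \<subseteq> vec_of_list ` {xs. set xs \<subseteq> (UNIV :: 'a set) \<and> length xs = n}"
  proof
    fix v :: "'a vec" assume "v \<in> carrier_vec n"
    then have "v = vec_of_list (list_of_vec v)" "length (list_of_vec v) = n"
      by (simp_all add: vec_list)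
    then show "v \<in> vec_of_list ` {xs. set xs \<subseteq> UNIV \<and> length xs = n}"
      by blast
  qed
qed (intro finite_imageI finite_lists_length_eq, simp)

lemma card_carrier_vec: "card (carrier_vec n :: 'a::finite vec set) = CARD('a) ^ n"
proof -
  have "bij_betw list_of_vec (carrier_vec n) {xs. set xs \<subseteq> (UNIV :: 'a set) \<and> length xs = n}"
    by (rule bij_betwI[where g = vec_of_list])
      (auto simp: vec_list list_vec intro!: carrier_vecI)
  then show ?thesis
    using bij_betw_same_card card_lists_length_eq[of "UNIV :: 'a set" n] by fastforce
qed

lemma additive_set_smult:
  fixes W :: "'a::nontriv mod_ring vec set"
  assumes W: "additive_set n W" and x: "x \<in> W"
  shows "a \<cdot>\<^sub>v x \<in> W"
proof -
  have xc: "x \<in> carrier_vec n"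
    using additive_setD(1)[OF W] x by blast
  have "(of_nat k :: 'a mod_ring) \<cdot>\<^sub>v x \<in> W" for k
  proof (induction k)
    case 0
    have "(0 :: 'a mod_ring) \<cdot>\<^sub>v x = 0\<^sub>v n"
      using xc by (intro eq_vecI) auto
    then show ?case
      using additive_setD(2)[OF W] by simp
  next
    case (Suc k)
    have "(of_nat (Suc k) :: 'a mod_ring) \<cdot>\<^sub>v x = x + of_nat k \<cdot>\<^sub>v x"
      using xc by (intro eq_vecI) (auto simp: algebra_simps)
    then show ?case
      using additive_setD(3)[OF W x Suc] by simp
  qed
  from this[of "nat (to_int_mod_ring a)"] show ?thesis
    using to_int_bounds(1)[of a] by simp
qed

lemma additive_set_imp_submodule:
  fixes W :: "Z5 vec set"
  assumes "additive_set n W"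
  shows "LinearCombinations.submodule class_ring W (module_vec TYPE(Z5) n)"
  unfolding submodule_def
  using vec_module additive_setD[OF assms] additive_set_smult[OF assms]
  by (auto simp: module_vec_simps)

lemma additive_set_span:
  assumes "S \<subseteq> carrier_vec n"
  shows "additive_set n (lin_span n S)" and "S \<subseteq> lin_span n S"
proof -
  interpret vec_space "TYPE(Z5)" n .
  have "LinearCombinations.submodule class_ring (span S) V"
    using assms by (rule span_is_submodule)
  then show "additive_set n (lin_span n S)"
    unfolding submodule_def additive_set_def lin_span_def by (auto simp: module_vec_simps)
  show "S \<subseteq> lin_span n S"
    unfolding lin_span_def using assms by (rule in_own_span)
qed

lemma lin_span_subset:
  assumes "additive_set n W" and "S \<subseteq> W"
  shows "lin_span n S \<subseteq> W"
  unfolding lin_span_def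
  using module.span_is_subset[OF vec_module assms(2) additive_set_imp_submodule[OF assms(1)]] .

text \<open>Turns dimensions into cardinalities, so that all rank bounds become counting arguments.
  Coordinates with respect to a basis B identify W with the functions from B to Z5.\<close>

lemma card_eq_power_lin_dim:
  assumes W: "additive_set n W"
  shows "card W = 5 ^ lin_dim n W"
proof -
  interpret W: vectorspace "class_ring :: Z5 ring" "(module_vec TYPE(Z5) n)\<lparr>carrier := W\<rparr>"
    using vectorspace.subspace_is_vs[OF vec_vs] additive_set_imp_submodule[OF W]
    by (auto simp: VectorSpace.subspace_def vec_vs)
  have fin: "finite W"
    using additive_setD(1)[OF W] finite_carrier_vec finite_subset by blast
  \<comment> \<open>The finite set W spans itself.\<close>
  have "W.fin_dim"
    unfolding W.fin_dim_def
    using fin W.span_is_subset2[of W] W.in_own_span[of W] by auto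
  then obtain B where B: "finite B" "W.basis B"
    using W.finite_basis_exists by blast
  then have BW: "B \<subseteq> W"
    by (auto simp: W.basis_def)
  have "bij_betw (\<lambda>a. W.lincomb a B) (B \<rightarrow>\<^sub>E UNIV) W"
  proof -
    have "\<forall>v. v \<in> W \<longrightarrow> (\<exists>!a. a \<in> B \<rightarrow>\<^sub>E UNIV \<and> W.lincomb a B = v)"
      using W.basis_criterion[of B] B BW by auto
    moreover have "W.lincomb a B \<in> W" for a
      using W.lincomb_closed[of B a] BW by auto
    ultimately show ?thesis
      unfolding bij_betw_def inj_on_def by (auto simp: image_iff)
  qed
  then have "card W = card (B \<rightarrow>\<^sub>E (UNIV :: Z5 set))"
    by (simp add: bij_betw_same_card)
  also have "\<dots> = 5 ^ card B"
    using B(1) by (simp add: card_PiE)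
  also have "card B = lin_dim n W"
    unfolding lin_dim_def using W.dim_basis[OF B] by simp
  finally show ?thesis .
qed

text \<open>Adding a generator s multiplies the size of the span by at most 5: the vectors a s + w,
  with w in the old span, form a subspace containing the new generating set, and they are
  parametrized by the pairs (a, w).\<close>

lemma card_lin_span_le:
  assumes "finite S" and "S \<subseteq> carrier_vec n"
  shows "card (lin_span n S) \<le> 5 ^ card S"
  using assms
proof (induction S)
  case empty
  have "additive_set n {0\<^sub>v n :: Z5 vec}"
    by (auto simp: additive_set_def)
  then have "lin_span n {} \<subseteq> {0\<^sub>v n}"
    by (rule lin_span_subset) simp
  then have "card (lin_span n {}) \<le> card {0\<^sub>v n :: Z5 vec}"
    by (intro card_mono) auto
  then show ?case
    by simp
next
  case (insert s S)
  let ?L = "lin_span n S"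
  let ?f = "\<lambda>(a :: Z5, w). a \<cdot>\<^sub>v s + w"
  have s: "s \<in> carrier_vec n" and S: "S \<subseteq> carrier_vec n"
    using insert.prems by auto
  note L = additive_set_span[OF S]
  have Lc: "?L \<subseteq> carrier_vec n"
    using additive_setD(1)[OF L(1)] .
  have z: "0\<^sub>v n = ?f (0, 0\<^sub>v n)"
    using s by (intro eq_vecI) auto
  have add: "?f (a, w) + ?f (b, v) = ?f (a + b, w + v)" if "w \<in> ?L" "v \<in> ?L" for a b w v
  proof -
    have "w \<in> carrier_vec n" "v \<in> carrier_vec n"
      using that Lc by auto
    then show ?thesis
      using s by (intro eq_vecI) (auto simp: algebra_simps)
  qed
  have "additive_set n (?f ` (UNIV \<times> ?L))"
    unfolding additive_set_def
  proof (intro conjI ballI)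
    show "?f ` (UNIV \<times> ?L) \<subseteq> carrier_vec n"
      using s Lc by auto
    show "0\<^sub>v n \<in> ?f ` (UNIV \<times> ?L)"
      using z additive_setD(2)[OF L(1)] by (intro image_eqI[of _ _ "(0, 0\<^sub>v n)"]) auto
    fix x y assume "x \<in> ?f ` (UNIV \<times> ?L)" "y \<in> ?f ` (UNIV \<times> ?L)"
    then obtain a w b v where "x = ?f (a, w)" "y = ?f (b, v)" "w \<in> ?L" "v \<in> ?L"
      by blast
    then show "x + y \<in> ?f ` (UNIV \<times> ?L)"
      using add[of w v a b] additive_setD(3)[OF L(1), of w v]
      by (intro image_eqI[of _ _ "(a + b, w + v)"]) auto
  qed
  moreover have "insert s S \<subseteq> ?f ` (UNIV \<times> ?L)"
  proof -
    have "s = ?f (1, 0\<^sub>v n)"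
      using s by (intro eq_vecI) auto
    then have "s \<in> ?f ` (UNIV \<times> ?L)"
      using additive_setD(2)[OF L(1)] by (intro image_eqI[of _ _ "(1, 0\<^sub>v n)"]) auto
    moreover have "x \<in> ?f ` (UNIV \<times> ?L)" if "x \<in> S" for x
    proof -
      have "x = ?f (0, x)"
        using s S that by (intro eq_vecI) auto
      then show ?thesis
        using L(2) that by (intro image_eqI[of _ _ "(0, x)"]) auto
    qed
    ultimately show ?thesis
      by auto
  qed
  ultimately have "lin_span n (insert s S) \<subseteq> ?f ` (UNIV \<times> ?L)"
    by (rule lin_span_subset)
  moreover have fin: "finite ?L"
    using Lc finite_carrier_vec finite_subset by blast
  ultimately have "card (lin_span n (insert s S)) \<le> card (?f ` (UNIV \<times> ?L))"
    by (intro card_mono) auto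
  also have "\<dots> \<le> card ((UNIV :: Z5 set) \<times> ?L)"
    using fin by (intro card_image_le) simp
  also have "\<dots> \<le> 5 * 5 ^ card S"
    using insert.IH[OF S] by (simp add: card_cartesian_product)
  finally show ?case
    using insert.hyps by simp
qed

lemma additive_set_eq_carrier_vec:
  fixes W :: "'a::nontriv mod_ring vec set"
  assumes W: "additive_set n W" and unit: "\<And>i. i < n \<Longrightarrow> unit_vec n i \<in> W"
  shows "W = carrier_vec n"
proof
  show "W \<subseteq> carrier_vec n"
    using additive_setD(1)[OF W] .
  show "carrier_vec n \<subseteq> W"
  proof
    fix v :: "'a mod_ring vec" assume v: "v \<in> carrier_vec n"
    \<comment> \<open>The truncations of v grow by one coordinate at a time, each time by a multiple
      of a unit vector.\<close>
    have "vec n (\<lambda>i. if i < k then v $ i else 0) \<in> W" if "k \<le> n" for k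
      using that
    proof (induction k)
      case 0
      have "vec n (\<lambda>i. if i < 0 then v $ i else 0) = 0\<^sub>v n"
        by auto
      then show ?case
        using additive_setD(2)[OF W] by simp
    next
      case (Suc k)
      have "vec n (\<lambda>i. if i < Suc k then v $ i else 0) =
          vec n (\<lambda>i. if i < k then v $ i else 0) + v $ k \<cdot>\<^sub>v unit_vec n k"
        using Suc.prems by (intro eq_vecI) (auto simp: less_Suc_eq)
      then show ?case
        using Suc additive_setD(3)[OF W] additive_set_smult[OF W unit] by simp
    qed
    from this[of n] have "vec n (\<lambda>i. if i < n then v $ i else 0) \<in> W"
      by simp
    also have "vec n (\<lambda>i. if i < n then v $ i else 0) = v"
      using v by (intro eq_vecI) auto
    finally show "v \<in> W" .
  qed
qed

section \<open>Carries of the Gray map\<close>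

lemma carrier_mixed_group:
  "carrier (mixed_group \<alpha> \<beta>) = carrier_vec \<alpha> \<times> carrier_vec \<beta>"
  by (simp add: mixed_group_def monoid_vec_simps)

lemma mult_mixed_group:
  "c \<otimes>\<^bsub>mixed_group \<alpha> \<beta>\<^esub> d = (fst c + fst d, snd c + snd d)"
  by (simp add: mixed_group_def monoid_vec_simps mult_DirProd')

lemma one_mixed_group: "\<one>\<^bsub>mixed_group \<alpha> \<beta>\<^esub> = (0\<^sub>v \<alpha>, 0\<^sub>v \<beta>)"
  by (simp add: mixed_group_def monoid_vec_simps)

lemmas mixed_group_simps = carrier_mixed_group mult_mixed_group one_mixed_group

context
  notes mixed_group_simps [simp]
begin

lemma comm_group_mixed_group: "comm_group (mixed_group \<alpha> \<beta>)"
proof -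
  have "group (mixed_group \<alpha> \<beta>)"
    unfolding mixed_group_def
    by (intro DirProd_group comm_group.axioms(2)[OF comm_group_vec])
  then show ?thesis
    by (rule group.group_comm_groupI) (auto simp: comm_add_vec)
qed

lemma pow_mixed_group:
  assumes "c \<in> carrier (mixed_group \<alpha> \<beta>)"
  shows "c [^]\<^bsub>mixed_group \<alpha> \<beta>\<^esub> (k :: nat) = (of_nat k \<cdot>\<^sub>v fst c, of_nat k \<cdot>\<^sub>v snd c)"
proof -
  interpret comm_group "mixed_group \<alpha> \<beta>"
    by (rule comm_group_mixed_group)
  show ?thesis
  proof (induction k)
    case 0
    show ?case
      using assms by (auto intro!: eq_vecI)
  next
    case (Suc k)
    show ?case
      unfolding nat_pow_Suc Suc using assms by (auto simp: algebra_simps intro!: eq_vecI)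
  qed
qed

text \<open>The value 0 beyond \<beta> makes residues of codewords comparable as functions, without
  range conditions on the index.\<close>

definition res :: "nat \<Rightarrow> mixed_vec \<Rightarrow> nat \<Rightarrow> Z5" where
  "res \<beta> c j = (if j < \<beta> then lo (snd c $ j) else 0)"

text \<open>\<open>tors \<alpha> \<beta> f\<close> is \<open>(0, 5 f)\<close>.\<close>

definition tors :: "nat \<Rightarrow> nat \<Rightarrow> (nat \<Rightarrow> Z5) \<Rightarrow> mixed_vec" where
  "tors \<alpha> \<beta> f = (0\<^sub>v \<alpha>, vec \<beta> (\<lambda>j. digits 0 (f j)))"

lemma tors_carrier [simp]: "tors \<alpha> \<beta> f \<in> carrier (mixed_group \<alpha> \<beta>)"
  by (simp add: tors_def)

lemma tors_cong: "(\<And>j. j < \<beta> \<Longrightarrow> f j = g j) \<Longrightarrow> tors \<alpha> \<beta> f = tors \<alpha> \<beta> g"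
  by (auto simp: tors_def)

lemma digits_0_0 [simp]: "digits 0 0 = 0"
  by (simp add: digits_def)

lemma digits_add: "digits 0 x + digits 0 y = digits 0 (x + y)"
  by (rule Z25_eqI) (simp_all add: hi_add)

lemma tors_0: "tors \<alpha> \<beta> (\<lambda>_. 0) = \<one>\<^bsub>mixed_group \<alpha> \<beta>\<^esub>"
  by (auto simp: tors_def)

lemma tors_add:
  "tors \<alpha> \<beta> f \<otimes>\<^bsub>mixed_group \<alpha> \<beta>\<^esub> tors \<alpha> \<beta> g = tors \<alpha> \<beta> (\<lambda>j. f j + g j)"
  by (auto simp: tors_def digits_add)

lemma res_add:
  assumes "c \<in> carrier (mixed_group \<alpha> \<beta>)" "d \<in> carrier (mixed_group \<alpha> \<beta>)"
  shows "res \<beta> (c \<otimes>\<^bsub>mixed_group \<alpha> \<beta>\<^esub> d) = (\<lambda>j. res \<beta> c j + res \<beta> d j)"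
  using assms by (auto simp: res_def)

lemma res_one [simp]: "res \<beta> (\<one>\<^bsub>mixed_group \<alpha> \<beta>\<^esub>) = (\<lambda>_. 0)"
  by (auto simp: res_def)

text \<open>Multiplication by 5 kills the Z5 part and the high digits, and moves the low digits up.
  So the multiples of 5 in the theorem are \<open>tors\<close> of products of residues.\<close>

lemma pow_5_mixed_group:
  assumes "c \<in> carrier (mixed_group \<alpha> \<beta>)"
  shows "c [^]\<^bsub>mixed_group \<alpha> \<beta>\<^esub> (5 :: nat) = tors \<alpha> \<beta> (res \<beta> c)"
proof -
  have "5 * u = digits 0 (lo u)" for u :: Z25
    by (rule Z25_eqI) simp_all
  then show ?thesis
    using assms by (auto simp: pow_mixed_group tors_def res_def intro!: eq_vecI)
qed

lemma mixed_prod_carrier [simp]: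
  assumes "c \<in> carrier (mixed_group \<alpha> \<beta>)"
  shows "c \<star> d \<in> carrier (mixed_group \<alpha> \<beta>)"
  using assms by (auto simp: mixed_prod_def)

lemma res_mixed_prod:
  assumes "c \<in> carrier (mixed_group \<alpha> \<beta>)"
  shows "res \<beta> (c \<star> d) = (\<lambda>j. res \<beta> c j * res \<beta> d j)"
  using assms by (auto simp: mixed_prod_def res_def)

section \<open>The Gray map in coordinates\<close>

lemma nth_concat_uniform:
  assumes "\<And>xs. xs \<in> set xss \<Longrightarrow> length xs = n" and "i < n * length xss"
  shows "concat xss ! i = xss ! (i div n) ! (i mod n)"
  using assms
proof (induction xss arbitrary: i)
  case (Cons xs xss)
  show ?case
  proof (cases "i < n")
    case True
    then show ?thesis
      using Cons.prems by (simp add: nth_append)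
  next
    case False
    moreover have "0 < n"
      using Cons.prems(2) by (cases n) auto
    ultimately have "i div n = Suc ((i - n) div n)" "i mod n = (i - n) mod n"
      by (auto simp: le_div_geq le_mod_geq)
    moreover have "concat xss ! (i - n) = xss ! ((i - n) div n) ! ((i - n) mod n)"
      using Cons.prems False by (intro Cons.IH) auto
    ultimately show ?thesis
      using Cons.prems False by (simp add: nth_append)
  qed
qed simp

lemma length_concat_uniform:
  assumes "\<And>xs. xs \<in> set xss \<Longrightarrow> length xs = n"
  shows "length (concat xss) = n * length xss"
  using assms by (induction xss) auto

lemma gray_eq: "gray Y u = hi u \<cdot>\<^sub>v vec 5 (\<lambda>_. 1) + lo u \<cdot>\<^sub>v Y"
  by (simp add: gray_def lo_def hi_def Let_def)

lemma Gray_eq: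
  assumes Y: "Y \<in> carrier_vec 5" and c: "c \<in> carrier (mixed_group \<alpha> \<beta>)"
  shows "Gray Y c = vec (\<alpha> + 5 * \<beta>) (\<lambda>i. if i < \<alpha> then fst c $ i else
    hi (snd c $ ((i - \<alpha>) div 5)) + lo (snd c $ ((i - \<alpha>) div 5)) * Y $ ((i - \<alpha>) mod 5))"
proof -
  let ?xss = "map (\<lambda>u. list_of_vec (gray Y u)) (list_of_vec (snd c))"
  have dims: "dim_vec (fst c) = \<alpha>" "dim_vec (snd c) = \<beta>" "dim_vec Y = 5"
    using Y c by auto
  have len: "length xs = 5" if "xs \<in> set ?xss" for xs
    using that dims by (auto simp: gray_eq)
  have "length (concat ?xss) = 5 * length ?xss"
    by (rule length_concat_uniform) (rule len)
  then have "length (concat ?xss) = 5 * \<beta>"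
    using dims by simp
  moreover have "concat ?xss ! i = hi (snd c $ (i div 5)) + lo (snd c $ (i div 5)) * Y $ (i mod 5)"
    if "i < 5 * \<beta>" for i
  proof -
    have "i div 5 < \<beta>"
      using that by auto
    moreover have "concat ?xss ! i = ?xss ! (i div 5) ! (i mod 5)"
      using that dims by (intro nth_concat_uniform len) auto
    ultimately show ?thesis
      using dims by (simp add: gray_eq list_of_vec_index)
  qed
  ultimately show ?thesis
    unfolding Gray_def using dims
    by (intro eq_vecI) (auto simp: vec_of_list_index simp del: length_concat)
qed

lemma Gray_carrier:
  assumes "Y \<in> carrier_vec 5" "c \<in> carrier (mixed_group \<alpha> \<beta>)"
  shows "Gray Y c \<in> carrier_vec (\<alpha> + 5 * \<beta>)"
  by (simp add: Gray_eq[OF assms])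

lemma Gray_tors:
  assumes "Y \<in> carrier_vec 5"
  shows "Gray Y (tors \<alpha> \<beta> f) =
    vec (\<alpha> + 5 * \<beta>) (\<lambda>i. if i < \<alpha> then 0 else f ((i - \<alpha>) div 5))"
proof -
  have "(i - \<alpha>) div 5 < \<beta>" if "i < \<alpha> + 5 * \<beta>" "\<not> i < \<alpha>" for i
    using that by auto
  then show ?thesis
    unfolding Gray_eq[OF assms tors_carrier] by (intro eq_vecI) (auto simp: tors_def)
qed

text \<open>Every coordinate is linear in the two digits. The carry enters through \<open>hi\<close>
  only, with the same value in all five positions of a block, and that is the Gray image of a
  multiple of 5.\<close>

lemma Gray_add:
  assumes Y: "Y \<in> carrier_vec 5"
    and c: "c \<in> carrier (mixed_group \<alpha> \<beta>)" and d: "d \<in> carrier (mixed_group \<alpha> \<beta>)"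
  shows "Gray Y (c \<otimes>\<^bsub>mixed_group \<alpha> \<beta>\<^esub> d) =
    Gray Y c + Gray Y d + Gray Y (tors \<alpha> \<beta> (\<lambda>j. carry (res \<beta> c j) (res \<beta> d j)))"
proof -
  interpret comm_group "mixed_group \<alpha> \<beta>"
    by (rule comm_group_mixed_group)
  have dims: "dim_vec (fst c) = \<alpha>" "dim_vec (snd c) = \<beta>"
    "dim_vec (fst d) = \<alpha>" "dim_vec (snd d) = \<beta>"
    using c d by auto
  have "(i - \<alpha>) div 5 < \<beta>" if "i < \<alpha> + 5 * \<beta>" "\<not> i < \<alpha>" for i
    using that by auto
  then show ?thesis
    unfolding Gray_eq[OF Y m_closed[OF c d]] Gray_eq[OF Y c] Gray_eq[OF Y d]
      Gray_tors[OF Y]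
    using dims by (intro eq_vecI) (auto simp: hi_add res_def algebra_simps)
qed

text \<open>A multiple of 5 has residue 0, so adding it produces no carry.\<close>

lemma Gray_add_tors:
  assumes "Y \<in> carrier_vec 5" "c \<in> carrier (mixed_group \<alpha> \<beta>)"
  shows "Gray Y (c \<otimes>\<^bsub>mixed_group \<alpha> \<beta>\<^esub> tors \<alpha> \<beta> f) = Gray Y c + Gray Y (tors \<alpha> \<beta> f)"
proof -
  have "res \<beta> (tors \<alpha> \<beta> f) = (\<lambda>_. 0)"
    by (auto simp: res_def tors_def)
  moreover have "Gray Y (tors \<alpha> \<beta> (\<lambda>_. 0)) = 0\<^sub>v (\<alpha> + 5 * \<beta>)"
    unfolding Gray_tors[OF assms(1)] by (intro eq_vecI) auto
  ultimately show ?thesis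
    using Gray_carrier[OF assms] Gray_carrier[OF assms(1) tors_carrier[of \<alpha> \<beta> f]]
    by (simp only: Gray_add[OF assms tors_carrier] carry_0) simp
qed

lemma Gray_tors_0:
  assumes "Y \<in> carrier_vec 5"
  shows "Gray Y (tors \<alpha> \<beta> (\<lambda>_. 0)) = 0\<^sub>v (\<alpha> + 5 * \<beta>)"
  unfolding Gray_tors[OF assms] by (intro eq_vecI) auto

lemma Gray_tors_add:
  assumes "Y \<in> carrier_vec 5"
  shows "Gray Y (tors \<alpha> \<beta> f) + Gray Y (tors \<alpha> \<beta> g) = Gray Y (tors \<alpha> \<beta> (\<lambda>j. f j + g j))"
  using Gray_add_tors[OF assms tors_carrier, of \<alpha> \<beta> f g] by (simp only: tors_add)

lemma Gray_tors_smult: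
  assumes "Y \<in> carrier_vec 5"
  shows "a \<cdot>\<^sub>v Gray Y (tors \<alpha> \<beta> f) = Gray Y (tors \<alpha> \<beta> (\<lambda>j. a * f j))"
  unfolding Gray_tors[OF assms] by (intro eq_vecI) auto

text \<open>Since Y lists all of Z5, a block determines the affine function y -> hi + lo y; its
  values at 0 and 1 return both digits.\<close>

lemma Gray_inj_on:
  assumes Y: "Y \<in> carrier_vec 5" and Y_UNIV: "set (list_of_vec Y) = UNIV"
  shows "inj_on (Gray Y) (carrier (mixed_group \<alpha> \<beta>))"
proof (rule inj_onI)
  fix c d
  assume c: "c \<in> carrier (mixed_group \<alpha> \<beta>)" and d: "d \<in> carrier (mixed_group \<alpha> \<beta>)"
    and eq: "Gray Y c = Gray Y d"
  have fst: "fst c $ i = fst d $ i" if "i < \<alpha>" for i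
    using that arg_cong[OF eq, of "\<lambda>v. v $ i"]
    by (simp add: Gray_eq[OF Y c] Gray_eq[OF Y d])
  have Yk: "\<exists>k<5. Y $ k = y" for y
    using Y_UNIV Y by (metis UNIV_I carrier_vecD in_set_conv_nth length_list_of_vec list_of_vec_index)
  have snd: "snd c $ j = snd d $ j" if "j < \<beta>" for j
  proof -
    have "hi (snd c $ j) + lo (snd c $ j) * Y $ k = hi (snd d $ j) + lo (snd d $ j) * Y $ k"
      if "k < 5" for k
      using \<open>j < \<beta>\<close> that arg_cong[OF eq, of "\<lambda>v. v $ (\<alpha> + 5 * j + k)"]
      by (simp add: Gray_eq[OF Y c] Gray_eq[OF Y d])
    then have *: "hi (snd c $ j) + lo (snd c $ j) * y = hi (snd d $ j) + lo (snd d $ j) * y" for y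
      using Yk by metis
    show ?thesis
      using *[of 0] *[of 1] by (intro Z25_eqI) simp_all
  qed
  have "fst c = fst d" "snd c = snd d"
    using c d fst snd by (auto intro!: eq_vecI)
  then show "c = d"
    by (simp add: prod_eq_iff)
qed

end

lemma tors_eq_one_iff:
  "tors \<alpha> \<beta> f = \<one>\<^bsub>mixed_group \<alpha> \<beta>\<^esub> \<longleftrightarrow> (\<forall>j<\<beta>. f j = 0)"
proof
  assume eq: "tors \<alpha> \<beta> f = \<one>\<^bsub>mixed_group \<alpha> \<beta>\<^esub>"
  show "\<forall>j<\<beta>. f j = 0"
  proof (intro allI impI)
    fix j assume "j < \<beta>"
    then have "digits 0 (f j) = 0"
      using arg_cong[OF eq, of "\<lambda>c. snd c $ j"] by (simp add: tors_def one_mixed_group)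
    then show "f j = 0"
      using hi_digits[of 0 "f j"] by simp
  qed
next
  assume "\<forall>j<\<beta>. f j = 0"
  then show "tors \<alpha> \<beta> f = \<one>\<^bsub>mixed_group \<alpha> \<beta>\<^esub>"
    by (subst tors_0[symmetric]) (auto intro: tors_cong)
qed

lemma pow_5_eq_one_iff:
  assumes "c \<in> carrier (mixed_group \<alpha> \<beta>)"
  shows "c [^]\<^bsub>mixed_group \<alpha> \<beta>\<^esub> (5 :: nat) = \<one>\<^bsub>mixed_group \<alpha> \<beta>\<^esub> \<longleftrightarrow> res \<beta> c = (\<lambda>_. 0)"
  unfolding pow_5_mixed_group[OF assms] tors_eq_one_iff by (auto simp: res_def fun_eq_iff)

section \<open>Polarization\<close>

text \<open>In the three identities x is a passive factor, and a power of one argument is split into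
  a product. The constants 2, 6 and 48 are units modulo 5.\<close>

lemma polarization_2:
  "2 * (x * y * z) = x * (y + z) * (y + z) - x * y * y - x * z * z" for x :: "'a::comm_ring_1"
  by (simp add: algebra_simps)

lemma polarization_3:
  "6 * (x * y * z * w) = x * (y + z + w) * (y + z + w) * (y + z + w)
    - x * (y + z) * (y + z) * (y + z) - x * (y + w) * (y + w) * (y + w)
    - x * (z + w) * (z + w) * (z + w) + x * y * y * y + x * z * z * z + x * w * w * w"
  for x :: "'a::comm_ring_1"
  by (simp add: algebra_simps)

text \<open>The difference q (y + s v) - q (y - s v) is 8 x (s v y^3 + s^3 v^3 y); combining s = 1
  and s = 2 eliminates the term with v^3.\<close>

lemma polarization_4:
  fixes x y v :: "'a::comm_ring_1"
  defines "q \<equiv> \<lambda>s. x * s * s * s * s"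
  shows "48 * (x * v * y * y * y) = 8 * (q (y + v) - q (y - v)) - (q (y + 2 * v) - q (y - 2 * v))"
  unfolding q_def by (simp add: algebra_simps)

text \<open>R stands for the residues of codewords, N for the functions f such that the Gray image
  of (0, 5 f) lies in the span.\<close>

locale carry_closed =
  fixes R N :: "(nat \<Rightarrow> Z5) set"
  assumes R_add: "x \<in> R \<Longrightarrow> y \<in> R \<Longrightarrow> (\<lambda>j. x j + y j) \<in> R"
    and N_add: "f \<in> N \<Longrightarrow> g \<in> N \<Longrightarrow> (\<lambda>j. f j + g j) \<in> N"
    and N_smult: "f \<in> N \<Longrightarrow> (\<lambda>j. a * f j) \<in> N"
    and carry_N: "x \<in> R \<Longrightarrow> y \<in> R \<Longrightarrow> (\<lambda>j. carry (x j) (y j)) \<in> N"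
begin

lemma N_diff: "f \<in> N \<Longrightarrow> g \<in> N \<Longrightarrow> (\<lambda>j. f j - g j) \<in> N"
  using N_add[OF _ N_smult[of g "-1"]] by simp

lemma R_2: "x \<in> R \<Longrightarrow> (\<lambda>j. 2 * x j) \<in> R"
  using R_add[of x x] by simp

lemma R_3: "x \<in> R \<Longrightarrow> (\<lambda>j. 3 * x j) \<in> R"
  using R_add[OF R_2, of x x] by simp

lemma R_4: "x \<in> R \<Longrightarrow> (\<lambda>j. 4 * x j) \<in> R"
  using R_2[OF R_2] by (simp add: algebra_simps)

lemma R_diff: "x \<in> R \<Longrightarrow> y \<in> R \<Longrightarrow> (\<lambda>j. x j - y j) \<in> R"
  \<comment> \<open>In Z5 the factor 4 is -1, so sums alone provide differences.\<close>
  using R_add[OF _ R_4[of y], of x] by (simp add: Z5_4)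

lemmas R_closed = R_add R_diff R_2 R_3 R_4
lemmas N_closed = N_add N_diff N_smult

lemma powers_N:
  assumes "x \<in> R" "y \<in> R"
  shows "(\<lambda>j. x j * y j * y j) \<in> N" "(\<lambda>j. x j * y j * y j * y j) \<in> N"
    "(\<lambda>j. x j * y j * y j * y j * y j) \<in> N"
proof -
  show "(\<lambda>j. x j * y j * y j) \<in> N"
    unfolding monomials_from_carry(1) using assms by (intro N_closed carry_N R_closed)
  show "(\<lambda>j. x j * y j * y j * y j) \<in> N"
    unfolding monomials_from_carry(2) using assms by (intro N_closed carry_N R_closed)
  show "(\<lambda>j. x j * y j * y j * y j * y j) \<in> N"
    unfolding monomials_from_carry(3) using assms by (intro N_closed carry_N R_closed)
qed

lemma product_3_N:
  assumes "x \<in> R" "y \<in> R" "z \<in> R"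
  shows "(\<lambda>j. x j * y j * z j) \<in> N"
proof -
  have "(\<lambda>j. 2 * (x j * y j * z j)) \<in> N"
    unfolding polarization_2 using assms by (intro N_closed powers_N R_closed)
  \<comment> \<open>3 is the inverse of 2 modulo 5.\<close>
  from N_smult[OF this, of 3] show ?thesis
    by (simp add: Z5_6 flip: mult.assoc)
qed

text \<open>The passive factor h is an arbitrary function, so the same polarization serves degree 4,
  with h = x, and degree 5, with h = x v.\<close>

lemma cubic_N:
  assumes h: "\<And>y. y \<in> R \<Longrightarrow> (\<lambda>j. h j * y j * y j * y j) \<in> N"
    and "y \<in> R" "z \<in> R" "w \<in> R"
  shows "(\<lambda>j. h j * y j * z j * w j) \<in> N"
proof -
  have "(\<lambda>j. 6 * (h j * y j * z j * w j)) \<in> N"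
    unfolding polarization_3 using assms(2-4) by (intro N_closed h R_closed)
  then show ?thesis
    by (simp add: Z5_6)
qed

lemma product_4_N:
  assumes "x \<in> R" "y \<in> R" "z \<in> R" "w \<in> R"
  shows "(\<lambda>j. x j * y j * z j * w j) \<in> N"
  using powers_N(2)[OF assms(1)] assms(2-4) by (rule cubic_N)

lemma product_5_N:
  assumes "x \<in> R" "v \<in> R" "y \<in> R" "z \<in> R" "w \<in> R"
  shows "(\<lambda>j. x j * v j * y j * z j * w j) \<in> N"
\<comment> \<open>It remains to treat x v y^3, one polarization step away from x y^4. The factor 48
  is cancelled by 2, since 96 is 1 modulo 5.\<close>
proof (rule cubic_N[OF _ assms(3-5)])
  fix y assume y: "y \<in> R"
  have "(\<lambda>j. 48 * (x j * v j * y j * y j * y j)) \<in> N"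
    unfolding polarization_4 using assms(1,2) y by (intro N_closed powers_N R_closed)
  from N_smult[OF this, of 2] show "(\<lambda>j. x j * v j * y j * y j * y j) \<in> N"
    by (simp add: Z5_96 flip: mult.assoc)
qed

end

section \<open>Products of three, four or five residues\<close>

lemma length_3_4_5:
  assumes "length ys \<in> {3, 4, 5}"
  obtains a b c where "ys = [a, b, c]"
  | a b c d where "ys = [a, b, c, d]"
  | a b c d e where "ys = [a, b, c, d, e]"
  using assms by (auto simp: numeral_eq_Suc length_Suc_conv)

definition fprod :: "(nat \<Rightarrow> Z5) list \<Rightarrow> nat \<Rightarrow> Z5" where
  "fprod fs j = prod_list (map (\<lambda>f. f j) fs)"

lemma (in carry_closed) fprod_N:
  assumes "set fs \<subseteq> R" "length fs \<in> {3, 4, 5}"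
  shows "fprod fs \<in> N"
  using assms(2)
proof (cases rule: length_3_4_5)
  case (1 x y z)
  then show ?thesis
    using product_3_N[of x y z] assms(1) by (simp add: fprod_def[abs_def] mult.assoc)
next
  case (2 x y z w)
  then show ?thesis
    using product_4_N[of x y z w] assms(1) by (simp add: fprod_def[abs_def] mult.assoc)
next
  case (3 x y z w v)
  then show ?thesis
    using product_5_N[of x y z w v] assms(1) by (simp add: fprod_def[abs_def] mult.assoc)
qed

text \<open>Setting for the converse inclusion: N is a linear space of functions, later the one that
  belongs to the span of the listed generators.\<close>

locale fprod_closed =
  fixes R N :: "(nat \<Rightarrow> Z5) set"
  assumes N_zero: "(\<lambda>_. 0) \<in> N"
    and N_add: "f \<in> N \<Longrightarrow> g \<in> N \<Longrightarrow> (\<lambda>j. f j + g j) \<in> N"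
    and N_smult: "f \<in> N \<Longrightarrow> (\<lambda>j. a * f j) \<in> N"
begin

text \<open>Every monomial of the carry polynomial is a product of three, four or five factors from
  R.\<close>

lemma carry_in_N:
  assumes fprod: "\<And>fs. set fs \<subseteq> R \<Longrightarrow> length fs \<in> {3, 4, 5} \<Longrightarrow> fprod fs \<in> N"
    and x: "x \<in> R" and y: "y \<in> R"
  shows "(\<lambda>j. carry (x j) (y j)) \<in> N"
proof -
  have 3: "(\<lambda>j. a j * b j * c j) \<in> N" if "a \<in> R" "b \<in> R" "c \<in> R" for a b c
    using fprod[of "[a, b, c]"] that by (simp add: fprod_def[abs_def] mult.assoc)
  have 4: "(\<lambda>j. a j * b j * c j * d j) \<in> N" if "a \<in> R" "b \<in> R" "c \<in> R" "d \<in> R" for a b c d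
    using fprod[of "[a, b, c, d]"] that by (simp add: fprod_def[abs_def] mult.assoc)
  have 5: "(\<lambda>j. a j * b j * c j * d j * e j) \<in> N"
    if "a \<in> R" "b \<in> R" "c \<in> R" "d \<in> R" "e \<in> R" for a b c d e
    using fprod[of "[a, b, c, d, e]"] that by (simp add: fprod_def[abs_def] mult.assoc)
  show ?thesis
    unfolding carry_polynomial using x y by (intro N_add N_smult 3 4 5)
qed

text \<open>Multilinearity: the factors are moved one at a time from \<open>R\<close> to the generators.\<close>

lemma fprod_N_of_generators:
  assumes R_induct: "\<And>P x. x \<in> R \<Longrightarrow> (\<And>y. y \<in> set gs \<Longrightarrow> P y) \<Longrightarrow> P (\<lambda>_. 0) \<Longrightarrow>
      (\<And>y z. P y \<Longrightarrow> P z \<Longrightarrow> P (\<lambda>j. y j + z j)) \<Longrightarrow> P x"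
    and sorted: "\<And>ks. sorted ks \<Longrightarrow> set ks \<subseteq> {..<length gs} \<Longrightarrow> length ks \<in> {3, 4, 5} \<Longrightarrow>
      fprod (map ((!) gs) ks) \<in> N"
    and fs: "set fs \<subseteq> R" "length fs \<in> {3, 4, 5}"
  shows "fprod fs \<in> N"
proof -
  \<comment> \<open>The list ks collects the indices of the generators that have replaced earlier
    factors.\<close>
  have "fprod (fs @ map ((!) gs) ks) \<in> N"
    if "set fs \<subseteq> R" "set ks \<subseteq> {..<length gs}" "length fs + length ks \<in> {3, 4, 5}" for ks
    using that
  proof (induction fs arbitrary: ks)
    case Nil
    have "fprod (map ((!) gs) (sort ks)) \<in> N"
      using Nil by (intro sorted) auto
    \<comment> \<open>The product is commutative, so sorted index lists represent all index
      lists.\<close>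
    moreover have "fprod (map ((!) gs) (sort ks)) = fprod (map ((!) gs) ks)"
    proof
      fix j
      have "prod_mset (mset (map (\<lambda>i. (gs ! i) j) (sort ks))) =
          prod_mset (mset (map (\<lambda>i. (gs ! i) j) ks))"
        by simp
      then show "fprod (map ((!) gs) (sort ks)) j = fprod (map ((!) gs) ks) j"
        unfolding prod_mset_prod_list by (simp add: fprod_def o_def)
    qed
    ultimately show ?case
      by simp
  next
    case (Cons f fs)
    let ?h = "fprod (fs @ map ((!) gs) ks)"
    \<comment> \<open>For fixed remaining factors h, the functions f with f h in N are closed under
      addition, so it suffices to let f be a generator.\<close>
    have "(\<lambda>j. f j * ?h j) \<in> N"
    proof (rule R_induct[of f])
      show "f \<in> R"
        using Cons.prems by simp
      show "(\<lambda>j. g j * ?h j) \<in> N" if g: "g \<in> set gs" for g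
      proof -
        obtain i where i: "i < length gs" "g = gs ! i"
          using g by (auto simp: in_set_conv_nth)
        have "fprod (fs @ map ((!) gs) (i # ks)) \<in> N"
          using Cons.prems i by (intro Cons.IH) auto
        then show ?thesis
          by (simp add: fprod_def[abs_def] i algebra_simps)
      qed
      show "(\<lambda>j. 0 * ?h j) \<in> N"
        using N_zero by simp
      show "(\<lambda>j. (y j + z j) * ?h j) \<in> N"
        if "(\<lambda>j. y j * ?h j) \<in> N" "(\<lambda>j. z j * ?h j) \<in> N" for y z
        using N_add[OF that] by (simp add: algebra_simps)
    qed
    then show ?case
      by (simp add: fprod_def[abs_def])
  qed
  from this[of "[]"] show ?thesis
    using fs by simp
qed

end

section \<open>Counting sorted index lists\<close>

lemma finite_sorted_lists:
  "finite {ks. sorted ks \<and> set ks \<subseteq> {..<d :: nat} \<and> length ks = k}"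
  by (rule finite_subset[OF _ finite_lists_length_eq[of "{..<d}" k]]) auto

text \<open>Sorted lists encode multisets. Either the last entry is the largest index e and can be
  removed, or all entries are below e; this is Pascal's recursion.\<close>

lemma card_sorted_lists_le:
  "card {ks. sorted ks \<and> set ks \<subseteq> {..<d :: nat} \<and> length ks = k} \<le> (d + k - 1) choose k"
  (is "card (?L d k) \<le> _")
proof (induction "d + k" arbitrary: d k rule: less_induct)
  case less
  show ?case
  proof (cases k)
    case 0
    then have L: "?L d k = {[]}"
      by auto
    show ?thesis
      unfolding L using 0 by simp
  next
    case (Suc l)
    show ?thesis
    proof (cases d)
      case 0
      then have L: "?L d k = {}"
        using Suc by auto
      show ?thesis
        unfolding L by simp
    next
      case d: (Suc e)
      have "?L d k \<subseteq> (\<lambda>ks. ks @ [e]) ` ?L d l \<union> ?L e k"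
      proof
        fix js assume js: "js \<in> ?L d k"
        then have "js \<noteq> []"
          using Suc by auto
        then obtain ks i where js_eq: "js = ks @ [i]"
          by (metis rev_exhaust)
        have i: "i \<le> e" "\<forall>x\<in>set ks. x \<le> i" "sorted ks" "length ks = l"
          using js Suc d by (auto simp: js_eq sorted_append)
        show "js \<in> (\<lambda>ks. ks @ [e]) ` ?L d l \<union> ?L e k"
        proof (cases "i = e")
          case True
          then show ?thesis
            using i d by (intro UnI1 image_eqI[of _ _ ks]) (auto simp: js_eq less_Suc_eq_le)
        next
          case False
          then show ?thesis
            using i js by (auto simp: js_eq)
        qed
      qed
      then have "card (?L d k) \<le> card ((\<lambda>ks. ks @ [e]) ` ?L d l \<union> ?L e k)"
        by (intro card_mono finite_UnI finite_imageI finite_sorted_lists)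
      also have "\<dots> \<le> card (?L d l) + card (?L e k)"
        using card_Un_le[of "(\<lambda>ks. ks @ [e]) ` ?L d l" "?L e k"]
          card_image_le[OF finite_sorted_lists[of d l], of "\<lambda>ks. ks @ [e]"] by linarith
      also have "\<dots> \<le> (d + l - 1 choose l) + (e + k - 1 choose k)"
        using Suc d by (intro add_mono less.hyps) auto
      also have "\<dots> = (d + k - 1 choose k)"
        using Suc d by simp
      finally show ?thesis .
    qed
  qed
qed

lemma image_setcompr:
  "h ` {f a b c | a b c. Q3 a b c} = {h (f a b c) | a b c. Q3 a b c}"
  "h ` {g a b c d | a b c d. Q4 a b c d} = {h (g a b c d) | a b c d. Q4 a b c d}"
  "h ` {k a b c d e | a b c d e. Q5 a b c d e} = {h (k a b c d e) | a b c d e. Q5 a b c d e}"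
  by blast+

section \<open>The span of the Gray image\<close>

locale additive_code_Gray =
  fixes \<alpha> \<beta> :: nat and Y :: "Z5 vec" and \<C> :: "mixed_vec set"
  assumes Y: "Y \<in> carrier_vec 5" and Y_UNIV: "set (list_of_vec Y) = UNIV"
    and subgroup: "subgroup \<C> (mixed_group \<alpha> \<beta>)"
begin

abbreviation "G \<equiv> mixed_group \<alpha> \<beta>"
abbreviation "n \<equiv> \<alpha> + 5 * \<beta>"
abbreviation "T \<equiv> tors \<alpha> \<beta>"

sublocale G: comm_group G
  by (rule comm_group_mixed_group)

sublocale \<C>: subgroup \<C> G
  by (rule subgroup)

lemma Gray_C: "Gray Y ` \<C> \<subseteq> carrier_vec n"
  using Gray_carrier[OF Y] \<C>.subset by blast

definition S :: "Z5 vec set" where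
  "S = lin_span n (Gray Y ` \<C>)"

lemma additive_S: "additive_set n S"
  unfolding S_def by (rule additive_set_span[OF Gray_C])

lemmas S_closed = additive_setD(3)[OF additive_S] additive_set_smult[OF additive_S]

lemma Gray_in_S: "c \<in> \<C> \<Longrightarrow> Gray Y c \<in> S"
  unfolding S_def using additive_set_span(2)[OF Gray_C] by blast

definition R :: "(nat \<Rightarrow> Z5) set" where
  "R = res \<beta> ` \<C>"

text \<open>The multiples of 5 whose Gray image the span contains. The Gray map is linear on
  multiples of 5, so \<open>N\<close> is a linear space.\<close>

definition N :: "(nat \<Rightarrow> Z5) set" where
  "N = {f. Gray Y (T f) \<in> S}"

lemma N_add: "f \<in> N \<Longrightarrow> g \<in> N \<Longrightarrow> (\<lambda>j. f j + g j) \<in> N"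
  unfolding N_def by (simp add: S_closed flip: Gray_tors_add[OF Y])

lemma N_smult: "f \<in> N \<Longrightarrow> (\<lambda>j. a * f j) \<in> N"
  unfolding N_def by (simp add: S_closed flip: Gray_tors_smult[OF Y])

lemma N_zero: "(\<lambda>_. 0) \<in> N"
  unfolding N_def using additive_setD(2)[OF additive_S] by (simp add: Gray_tors_0[OF Y])

lemma R_add:
  assumes "x \<in> R" "y \<in> R"
  shows "(\<lambda>j. x j + y j) \<in> R"
proof -
  obtain c d where "c \<in> \<C>" "d \<in> \<C>" "x = res \<beta> c" "y = res \<beta> d"
    using assms by (auto simp: R_def)
  then show ?thesis
    unfolding R_def by (intro image_eqI[of _ _ "c \<otimes>\<^bsub>G\<^esub> d"]) (simp_all add: res_add)
qed

text \<open>The carry is the obstruction to additivity of the Gray map: its image is a difference of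
  elements of the span.\<close>

lemma carry_N:
  assumes "x \<in> R" "y \<in> R"
  shows "(\<lambda>j. carry (x j) (y j)) \<in> N"
proof -
  obtain c d where cd: "c \<in> \<C>" "d \<in> \<C>" "x = res \<beta> c" "y = res \<beta> d"
    using assms by (auto simp: R_def)
  let ?t = "Gray Y (T (\<lambda>j. carry (x j) (y j)))"
  have c: "Gray Y c \<in> carrier_vec n" and d: "Gray Y d \<in> carrier_vec n"
    and t: "?t \<in> carrier_vec n"
    using cd(1,2) Gray_C Gray_carrier[OF Y tors_carrier] by auto
  have "Gray Y (c \<otimes>\<^bsub>G\<^esub> d) + (-1) \<cdot>\<^sub>v (Gray Y c + Gray Y d) \<in> S"
    using cd by (intro S_closed Gray_in_S) auto
  also have "Gray Y (c \<otimes>\<^bsub>G\<^esub> d) + (-1) \<cdot>\<^sub>v (Gray Y c + Gray Y d) = ?t"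
    unfolding Gray_add[OF Y \<C>.mem_carrier[OF cd(1)] \<C>.mem_carrier[OF cd(2)]] cd(3,4)
    using c d t[unfolded cd(3,4)] by (intro eq_vecI) auto
  finally show ?thesis
    by (simp add: N_def)
qed

sublocale carry_closed R N
  by unfold_locales (fact R_add N_add N_smult carry_N)+

text \<open>The code that realizes the span: adjoining these multiples of 5 to \<C> provides room to
  cancel every carry.\<close>

definition \<D> :: "mixed_vec set" where
  "\<D> = {c \<otimes>\<^bsub>G\<^esub> T f | c f. c \<in> \<C> \<and> f \<in> N}"

lemma D_I: "c \<in> \<C> \<Longrightarrow> f \<in> N \<Longrightarrow> c \<otimes>\<^bsub>G\<^esub> T f \<in> \<D>"
  unfolding \<D>_def by blast

lemma tors_add_uminus:
  "T f \<otimes>\<^bsub>G\<^esub> T (\<lambda>j. - f j) = \<one>\<^bsub>G\<^esub>"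
  unfolding tors_add by (simp add: tors_0)

lemma subgroup_D: "subgroup \<D> G"
proof (rule G.subgroupI)
  show "\<D> \<subseteq> carrier G"
    unfolding \<D>_def using G.m_closed[OF \<C>.mem_carrier tors_carrier] by blast
  show "\<D> \<noteq> {}"
    unfolding \<D>_def using \<C>.one_closed N_zero by blast
next
  fix d assume "d \<in> \<D>"
  then obtain c f where d: "d = c \<otimes>\<^bsub>G\<^esub> T f" "c \<in> \<C>" "f \<in> N"
    unfolding \<D>_def by blast
  have "inv\<^bsub>G\<^esub> (T f) = T (\<lambda>j. - f j)"
    using tors_add_uminus[of "\<lambda>j. - f j"] by (intro G.inv_equality) simp_all
  then have "inv\<^bsub>G\<^esub> d = inv\<^bsub>G\<^esub> c \<otimes>\<^bsub>G\<^esub> T (\<lambda>j. - f j)"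
    unfolding d(1) by (simp only: G.inv_mult[OF \<C>.mem_carrier[OF d(2)] tors_carrier])
  then show "inv\<^bsub>G\<^esub> d \<in> \<D>"
    using D_I[OF \<C>.m_inv_closed[OF d(2)] N_smult[OF d(3), of "-1"]] by simp
next
  fix d e assume "d \<in> \<D>" "e \<in> \<D>"
  then obtain c f c' f' where *: "d = c \<otimes>\<^bsub>G\<^esub> T f" "c \<in> \<C>" "f \<in> N"
    "e = c' \<otimes>\<^bsub>G\<^esub> T f'" "c' \<in> \<C>" "f' \<in> N"
    unfolding \<D>_def by blast
  have "d \<otimes>\<^bsub>G\<^esub> e = (c \<otimes>\<^bsub>G\<^esub> c') \<otimes>\<^bsub>G\<^esub> (T f \<otimes>\<^bsub>G\<^esub> T f')"
    unfolding *(1,4)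
    using \<C>.mem_carrier[OF *(2)] \<C>.mem_carrier[OF *(5)] tors_carrier[of \<alpha> \<beta> f] tors_carrier[of \<alpha> \<beta> f']
    by (simp only: G.m_ac G.m_closed)
  then show "d \<otimes>\<^bsub>G\<^esub> e \<in> \<D>"
    unfolding \<D>_def tors_add using \<C>.m_closed[OF *(2,5)] N_add[OF *(3,6)] by blast
qed

lemma Gray_D_in_S: "d \<in> \<D> \<Longrightarrow> Gray Y d \<in> S"
  unfolding \<D>_def N_def
  using S_closed(1) Gray_in_S by (auto simp: Gray_add_tors[OF Y])

text \<open>The Gray image of \<D> is closed under addition, because the carry of two codewords lies
  in \<open>N\<close> and can be subtracted inside \<D>. It is thus a subspace between the Gray
  image of \<C> and its span.\<close>

lemma Gray_image_D: "Gray Y ` \<D> = S"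
proof
  show "Gray Y ` \<D> \<subseteq> S"
    using Gray_D_in_S by blast
  have sub: "Gray Y ` \<D> \<subseteq> carrier_vec n"
    using Gray_carrier[OF Y] subgroup.subset[OF subgroup_D] by blast
  have C_D: "\<C> \<subseteq> \<D>"
  proof
    fix c assume "c \<in> \<C>"
    moreover from this have "c = c \<otimes>\<^bsub>G\<^esub> T (\<lambda>_. 0)"
      by (simp only: tors_0 G.r_one \<C>.mem_carrier)
    ultimately show "c \<in> \<D>"
      unfolding \<D>_def using N_zero by blast
  qed
  have "additive_set n (Gray Y ` \<D>)"
    unfolding additive_set_def
  proof (intro conjI ballI sub)
    have "T (\<lambda>_. 0) \<in> \<D>"
      using C_D \<C>.one_closed unfolding tors_0 by blast
    then show "0\<^sub>v n \<in> Gray Y ` \<D>"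
      unfolding Gray_tors_0[OF Y, symmetric] by (rule imageI)
  next
    fix p q assume "p \<in> Gray Y ` \<D>" "q \<in> Gray Y ` \<D>"
    then obtain c f c' f' where *: "p = Gray Y (c \<otimes>\<^bsub>G\<^esub> T f)" "c \<in> \<C>" "f \<in> N"
      "q = Gray Y (c' \<otimes>\<^bsub>G\<^esub> T f')" "c' \<in> \<C>" "f' \<in> N"
      unfolding \<D>_def by blast
    define h where "h j = carry (res \<beta> c j) (res \<beta> c' j)" for j
    have h: "h \<in> N"
      using carry_N[of "res \<beta> c" "res \<beta> c'"] *(2,5) by (simp add: R_def h_def[abs_def])
    note cc = \<C>.mem_carrier[OF *(2)] \<C>.mem_carrier[OF *(5)]
    \<comment> \<open>The summand with coefficient -1 cancels the carry h created by adding c and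
      c'.\<close>
    have "p + q = Gray Y ((c \<otimes>\<^bsub>G\<^esub> c') \<otimes>\<^bsub>G\<^esub> T (\<lambda>j. (f j + f' j) + (- 1) * h j))"
      unfolding *(1,4) Gray_add_tors[OF Y cc(1)] Gray_add_tors[OF Y cc(2)]
        Gray_add_tors[OF Y G.m_closed[OF cc]] Gray_add[OF Y cc] h_def[symmetric]
        Gray_tors_add[OF Y, symmetric] Gray_tors_smult[OF Y, symmetric]
      using Gray_carrier[OF Y cc(1)] Gray_carrier[OF Y cc(2)] Gray_carrier[OF Y tors_carrier, of \<alpha> \<beta> f]
        Gray_carrier[OF Y tors_carrier, of \<alpha> \<beta> f'] Gray_carrier[OF Y tors_carrier, of \<alpha> \<beta> h]
      by (intro eq_vecI) auto
    moreover have "(\<lambda>j. (f j + f' j) + (- 1) * h j) \<in> N"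
      using *(3,6) h by (intro N_add N_smult)
    ultimately show "p + q \<in> Gray Y ` \<D>"
      unfolding \<D>_def using \<C>.m_closed[OF *(2,5)] by blast
  qed
  then show "S \<subseteq> Gray Y ` \<D>"
    unfolding S_def using C_D by (intro lin_span_subset) auto
qed

lemma mixed_linear_S: "mixed_linear Y \<alpha> \<beta> S"
  unfolding mixed_linear_def additive_code_def using subgroup_D Gray_image_D by blast

section \<open>A generating set of the span\<close>

definition gens :: "mixed_vec list \<Rightarrow> mixed_vec list \<Rightarrow> Z5 vec set" where
  "gens us vs = Gray Y ` set us \<union> Gray Y ` set vs \<union>
    (\<lambda>ks. Gray Y (T (fprod (map (\<lambda>i. res \<beta> (vs ! i)) ks)))) `
      {ks. sorted ks \<and> set ks \<subseteq> {..<length vs} \<and> length ks \<in> {3, 4, 5}}"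

text \<open>The common consequence of a generator matrix and of an isomorphism with the standard
  group. Stating generation through closed subsets yields an induction principle at once.\<close>

definition generates :: "mixed_vec list \<Rightarrow> mixed_vec list \<Rightarrow> bool" where
  "generates us vs \<longleftrightarrow> set us \<subseteq> \<C> \<and> set vs \<subseteq> \<C> \<and>
    (\<forall>u\<in>set us. u [^]\<^bsub>G\<^esub> (5 :: nat) = \<one>\<^bsub>G\<^esub>) \<and>
    (\<forall>A\<subseteq>\<C>. set us \<subseteq> A \<longrightarrow> set vs \<subseteq> A \<longrightarrow> \<one>\<^bsub>G\<^esub> \<in> A \<longrightarrow>
      (\<forall>c\<in>A. \<forall>d\<in>A. c \<otimes>\<^bsub>G\<^esub> d \<in> A) \<longrightarrow> A = \<C>)"

lemma generates_induct:
  assumes "generates us vs" and "c \<in> \<C>"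
    and "\<And>u. u \<in> set us \<Longrightarrow> P u" and "\<And>v. v \<in> set vs \<Longrightarrow> P v" and "P \<one>\<^bsub>G\<^esub>"
    and "\<And>c d. c \<in> \<C> \<Longrightarrow> d \<in> \<C> \<Longrightarrow> P c \<Longrightarrow> P d \<Longrightarrow> P (c \<otimes>\<^bsub>G\<^esub> d)"
  shows "P c"
proof -
  have "{c \<in> \<C>. P c} = \<C>"
  proof -
    have "set us \<subseteq> \<C>" "set vs \<subseteq> \<C>"
      using assms(1) by (simp_all add: generates_def)
    then have "set us \<subseteq> {c \<in> \<C>. P c}" "set vs \<subseteq> {c \<in> \<C>. P c}"
      using assms(3,4) by auto
    moreover have "A = \<C>" if "A \<subseteq> \<C>" "set us \<subseteq> A" "set vs \<subseteq> A" "\<one>\<^bsub>G\<^esub> \<in> A"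
      "\<forall>c\<in>A. \<forall>d\<in>A. c \<otimes>\<^bsub>G\<^esub> d \<in> A" for A
      using assms(1) that unfolding generates_def by (elim conjE) simp
    ultimately show ?thesis
      using assms(5,6) by simp
  qed
  then show ?thesis
    using assms(2) by blast
qed

lemma res_order_5:
  assumes "generates us vs" and "u \<in> set us"
  shows "res \<beta> u = (\<lambda>_. 0)"
  using assms pow_5_eq_one_iff[of u \<alpha> \<beta>] \<C>.mem_carrier unfolding generates_def by blast

text \<open>Rows of order dividing 5 have residue 0, so the residues of \<open>vs\<close> alone
  generate \<open>R\<close>. This is why only rows of \<open>vs\<close> occur in the
  products.\<close>

lemma R_induct:
  assumes gen: "generates us vs" and "x \<in> R"
    and "\<And>v. v \<in> set vs \<Longrightarrow> P (res \<beta> v)" and zero: "P (\<lambda>_. 0)"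
    and add: "\<And>y z. P y \<Longrightarrow> P z \<Longrightarrow> P (\<lambda>j. y j + z j)"
  shows "P x"
proof -
  obtain c where c: "c \<in> \<C>" "x = res \<beta> c"
    using assms(2) by (auto simp: R_def)
  have "P (res \<beta> c)"
    using gen c(1)
  proof (rule generates_induct)
    show "P (res \<beta> u)" if "u \<in> set us" for u
      using res_order_5[OF gen that] zero by simp
    show "P (res \<beta> (c \<otimes>\<^bsub>G\<^esub> d))" if "c \<in> \<C>" "d \<in> \<C>" "P (res \<beta> c)" "P (res \<beta> d)" for c d
      using add[OF that(3,4)] res_add[of c \<alpha> \<beta> d] that(1,2) by simp
  qed (use assms(3) zero in simp_all)
  then show ?thesis
    using c by simp
qed

lemma gens_subset_S:
  assumes "generates us vs"
  shows "gens us vs \<subseteq> S"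
  unfolding gens_def
proof (intro Un_least image_subsetI)
  have us: "set us \<subseteq> \<C>" and vs: "set vs \<subseteq> \<C>"
    using assms by (simp_all add: generates_def)
  show "Gray Y u \<in> S" if "u \<in> set us" for u
    using us that by (intro Gray_in_S) auto
  show "Gray Y v \<in> S" if "v \<in> set vs" for v
    using vs that by (intro Gray_in_S) auto
  fix ks assume "ks \<in> {ks. sorted ks \<and> set ks \<subseteq> {..<length vs} \<and> length ks \<in> {3, 4, 5}}"
  then have ks: "set ks \<subseteq> {..<length vs}" "length ks \<in> {3, 4, 5}"
    by simp_all
  have "res \<beta> (vs ! i) \<in> R" if "i \<in> set ks" for i
  proof -
    have "i < length vs"
      using ks(1) that by auto
    then show ?thesis
      using vs nth_mem[of i vs] unfolding R_def by blast
  qed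
  then have "fprod (map (\<lambda>i. res \<beta> (vs ! i)) ks) \<in> N"
    using ks(2) by (intro fprod_N) auto
  then show "Gray Y (T (fprod (map (\<lambda>i. res \<beta> (vs ! i)) ks))) \<in> S"
    by (simp add: N_def)
qed

text \<open>By multilinearity the span of the generators contains all products of three, four or
  five residues, hence all carries. Induction over the code then places every Gray image in
  it.\<close>

lemma S_eq_span_gens:
  assumes gen: "generates us vs"
  shows "S = lin_span n (gens us vs)"
proof
  show "lin_span n (gens us vs) \<subseteq> S"
    using gens_subset_S[OF gen] by (intro lin_span_subset additive_S)
  let ?L = "lin_span n (gens us vs)"
  have gens_c: "gens us vs \<subseteq> carrier_vec n"
    using gens_subset_S[OF gen] additive_setD(1)[OF additive_S] by blast
  note L = additive_set_span[OF gens_c]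
  define M where "M = {f. Gray Y (T f) \<in> ?L}"
  interpret M: fprod_closed R M
  proof
    show "(\<lambda>_. 0) \<in> M"
      unfolding M_def using additive_setD(2)[OF L(1)] by (simp add: Gray_tors_0[OF Y])
    show "(\<lambda>j. f j + g j) \<in> M" if "f \<in> M" "g \<in> M" for f g
      using that additive_setD(3)[OF L(1)] unfolding M_def by (simp flip: Gray_tors_add[OF Y])
    show "(\<lambda>j. a * f j) \<in> M" if "f \<in> M" for f a
      using that additive_set_smult[OF L(1)] unfolding M_def by (simp flip: Gray_tors_smult[OF Y])
  qed
  have fprod_M: "fprod fs \<in> M" if "set fs \<subseteq> R" "length fs \<in> {3, 4, 5}" for fs
  proof (rule M.fprod_N_of_generators[of "map (res \<beta>) vs", OF _ _ that])
    show "P x" if "x \<in> R" "\<And>y. y \<in> set (map (res \<beta>) vs) \<Longrightarrow> P y" "P (\<lambda>_. 0)"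
      "\<And>y z. P y \<Longrightarrow> P z \<Longrightarrow> P (\<lambda>j. y j + z j)" for P x
      using R_induct[OF gen that(1), of P] that by simp
    fix ks :: "nat list"
    assume ks: "sorted ks" "set ks \<subseteq> {..<length (map (res \<beta>) vs)}" "length ks \<in> {3, 4, 5}"
    then have map_eq: "map ((!) (map (res \<beta>) vs)) ks = map (\<lambda>i. res \<beta> (vs ! i)) ks"
      by (auto simp: subset_iff)
    have "Gray Y (T (fprod (map (\<lambda>i. res \<beta> (vs ! i)) ks))) \<in> gens us vs"
      using ks unfolding gens_def by auto
    then show "fprod (map ((!) (map (res \<beta>) vs)) ks) \<in> M"
      using L(2) unfolding map_eq M_def by auto
  qed
  have "Gray Y c \<in> ?L" if "c \<in> \<C>" for c
    using gen that
  proof (rule generates_induct)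
    show "Gray Y u \<in> ?L" if "u \<in> set us" for u
      using that L(2) unfolding gens_def by blast
    show "Gray Y v \<in> ?L" if "v \<in> set vs" for v
      using that L(2) unfolding gens_def by blast
    show "Gray Y \<one>\<^bsub>G\<^esub> \<in> ?L"
      using additive_setD(2)[OF L(1)] by (simp add: Gray_tors_0[OF Y] flip: tors_0)
    fix c d assume *: "c \<in> \<C>" "d \<in> \<C>" "Gray Y c \<in> ?L" "Gray Y d \<in> ?L"
    then have "(\<lambda>j. carry (res \<beta> c j) (res \<beta> d j)) \<in> M"
      by (intro M.carry_in_N fprod_M) (auto simp: R_def)
    then show "Gray Y (c \<otimes>\<^bsub>G\<^esub> d) \<in> ?L"
      unfolding Gray_add[OF Y \<C>.mem_carrier[OF *(1)] \<C>.mem_carrier[OF *(2)]] M_def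
      using *(3,4) by (intro additive_setD(3)[OF L(1)]) auto
  qed
  then show "S \<subseteq> ?L"
    unfolding S_def by (intro lin_span_subset L(1)) blast
qed

lemma card_gens_le:
  "card (gens us vs) \<le> length us + length vs + (length vs + 2 choose 3) +
    (length vs + 3 choose 4) + (length vs + 4 choose 5)"
  and finite_gens: "finite (gens us vs)"
proof -
  let ?L = "\<lambda>k. {ks. sorted ks \<and> set ks \<subseteq> {..<length vs} \<and> length ks = k}"
  have L: "{ks. sorted ks \<and> set ks \<subseteq> {..<length vs} \<and> length ks \<in> {3, 4, 5}} =
      ?L 3 \<union> ?L 4 \<union> ?L 5"
    by auto
  show "finite (gens us vs)"
    unfolding gens_def L by (intro finite_UnI finite_imageI finite_sorted_lists) auto
  have "card (gens us vs) \<le> card (set us) + card (set vs) + card (?L 3 \<union> ?L 4 \<union> ?L 5)"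
    unfolding gens_def L
    by (intro order_trans[OF card_Un_le] add_mono card_image_le finite_UnI finite_sorted_lists) auto
  also have "\<dots> \<le> length us + length vs + ((length vs + 3 - 1 choose 3) +
      (length vs + 4 - 1 choose 4) + (length vs + 5 - 1 choose 5))"
    by (intro order_trans[OF card_Un_le] add_mono card_sorted_lists_le card_length)
  finally show "card (gens us vs) \<le> length us + length vs + (length vs + 2 choose 3) +
    (length vs + 3 choose 4) + (length vs + 4 choose 5)"
    by (simp add: ac_simps)
qed

section \<open>Rank\<close>

text \<open>Translates sorted index lists of length 3, 4 and 5 into chains of indices, and
  \<open>tors\<close> of a product of residues into 5 times a product of rows.\<close>

lemma gens_eq:
  assumes "generates us vs"
  shows "gens us vs =
    {Gray Y (us ! i) | i. i < length us} \<union>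
    {Gray Y (vs ! j) | j. j < length vs} \<union>
    {Gray Y ((vs ! i1 \<star> vs ! i2 \<star> vs ! i3) [^]\<^bsub>G\<^esub> (5::nat)) | i1 i2 i3.
      i1 \<le> i2 \<and> i2 \<le> i3 \<and> i3 < length vs} \<union>
    {Gray Y ((vs ! i1 \<star> vs ! i2 \<star> vs ! i3 \<star> vs ! i4) [^]\<^bsub>G\<^esub> (5::nat)) | i1 i2 i3 i4.
      i1 \<le> i2 \<and> i2 \<le> i3 \<and> i3 \<le> i4 \<and> i4 < length vs} \<union>
    {Gray Y ((vs ! i1 \<star> vs ! i2 \<star> vs ! i3 \<star> vs ! i4 \<star> vs ! i5) [^]\<^bsub>G\<^esub> (5::nat)) | i1 i2 i3 i4 i5.
      i1 \<le> i2 \<and> i2 \<le> i3 \<and> i3 \<le> i4 \<and> i4 \<le> i5 \<and> i5 < length vs}"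
    (is "_ = _ \<union> _ \<union> ?P3 \<union> ?P4 \<union> ?P5")
proof -
  let ?L = "\<lambda>k. {ks. sorted ks \<and> set ks \<subseteq> {..<length vs} \<and> length ks = k}"
  define h where "h ks = Gray Y (T (fprod (map (\<lambda>i. res \<beta> (vs ! i)) ks)))" for ks
  have v: "vs ! i \<in> carrier G" if "i < length vs" for i
    using assms that nth_mem[of i vs] \<C>.mem_carrier unfolding generates_def by blast
  have nth: "{f (xs ! i) | i. i < length xs} = f ` set xs" for f :: "mixed_vec \<Rightarrow> Z5 vec" and xs
    by (auto simp: set_conv_nth)
  have h3: "h [i1, i2, i3] = Gray Y ((vs ! i1 \<star> vs ! i2 \<star> vs ! i3) [^]\<^bsub>G\<^esub> (5::nat))"
    if "i1 \<le> i2 \<and> i2 \<le> i3 \<and> i3 < length vs" for i1 i2 i3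
    using that v[of i1] by (simp add: h_def pow_5_mixed_group res_mixed_prod[where \<alpha> = \<alpha>] fprod_def[abs_def] mult.assoc)
  have "?L 3 = {[i1, i2, i3] | i1 i2 i3. i1 \<le> i2 \<and> i2 \<le> i3 \<and> i3 < length vs}"
    by (auto simp: numeral_eq_Suc length_Suc_conv)
  then have "h ` ?L 3 = {h [i1, i2, i3] | i1 i2 i3. i1 \<le> i2 \<and> i2 \<le> i3 \<and> i3 < length vs}"
    by (simp only: image_setcompr(1))
  also have "\<dots> = ?P3"
    by (intro Collect_cong ex_cong1) (simp add: h3 cong: rev_conj_cong)
  finally have P3: "h ` ?L 3 = ?P3" .
  have h4: "h [i1, i2, i3, i4] = Gray Y ((vs ! i1 \<star> vs ! i2 \<star> vs ! i3 \<star> vs ! i4) [^]\<^bsub>G\<^esub> (5::nat))"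
    if "i1 \<le> i2 \<and> i2 \<le> i3 \<and> i3 \<le> i4 \<and> i4 < length vs" for i1 i2 i3 i4
    using that v[of i1] by (simp add: h_def pow_5_mixed_group res_mixed_prod[where \<alpha> = \<alpha>] fprod_def[abs_def] mult.assoc)
  have "?L 4 = {[i1, i2, i3, i4] | i1 i2 i3 i4. i1 \<le> i2 \<and> i2 \<le> i3 \<and> i3 \<le> i4 \<and> i4 < length vs}"
    by (auto simp: numeral_eq_Suc length_Suc_conv)
  then have "h ` ?L 4 = {h [i1, i2, i3, i4] | i1 i2 i3 i4. i1 \<le> i2 \<and> i2 \<le> i3 \<and> i3 \<le> i4 \<and> i4 < length vs}"
    by (simp only: image_setcompr(2))
  also have "\<dots> = ?P4"
    by (intro Collect_cong ex_cong1) (simp add: h4 cong: rev_conj_cong)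
  finally have P4: "h ` ?L 4 = ?P4" .
  have h5: "h [i1, i2, i3, i4, i5] = Gray Y ((vs ! i1 \<star> vs ! i2 \<star> vs ! i3 \<star> vs ! i4 \<star> vs ! i5) [^]\<^bsub>G\<^esub> (5::nat))"
    if "i1 \<le> i2 \<and> i2 \<le> i3 \<and> i3 \<le> i4 \<and> i4 \<le> i5 \<and> i5 < length vs" for i1 i2 i3 i4 i5
    using that v[of i1] by (simp add: h_def pow_5_mixed_group res_mixed_prod[where \<alpha> = \<alpha>] fprod_def[abs_def] mult.assoc)
  have "?L 5 = {[i1, i2, i3, i4, i5] | i1 i2 i3 i4 i5. i1 \<le> i2 \<and> i2 \<le> i3 \<and> i3 \<le> i4 \<and> i4 \<le> i5 \<and> i5 < length vs}"
    by (auto simp: numeral_eq_Suc length_Suc_conv)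
  then have "h ` ?L 5 = {h [i1, i2, i3, i4, i5] | i1 i2 i3 i4 i5. i1 \<le> i2 \<and> i2 \<le> i3 \<and> i3 \<le> i4 \<and> i4 \<le> i5 \<and> i5 < length vs}"
    by (simp only: image_setcompr(3))
  also have "\<dots> = ?P5"
    by (intro Collect_cong ex_cong1) (simp add: h5 cong: rev_conj_cong)
  finally have P5: "h ` ?L 5 = ?P5" .
  have "{ks. sorted ks \<and> set ks \<subseteq> {..<length vs} \<and> length ks \<in> {3, 4, 5}} = ?L 3 \<union> ?L 4 \<union> ?L 5"
    by auto
  then show ?thesis
    unfolding gens_def nth P3[symmetric] P4[symmetric] P5[symmetric] h_def[symmetric]
    by (simp only: image_Un Un_assoc)
qed

lemma finite_R: "finite R"
  unfolding R_def
  by (intro finite_imageI finite_subset[OF \<C>.subset]) (simp add: carrier_mixed_group)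

text \<open>The residues lie in the linear span of the residues of \<open>vs\<close>.\<close>

lemma card_R_le:
  assumes "generates us vs"
  shows "card R \<le> 5 ^ length vs"
proof -
  let ?vec = "\<lambda>x. vec \<beta> (x :: nat \<Rightarrow> Z5)"
  let ?V = "set (map (\<lambda>v. ?vec (res \<beta> v)) vs)"
  let ?L = "lin_span \<beta> ?V"
  have V: "?V \<subseteq> carrier_vec \<beta>"
    by auto
  note L = additive_set_span[OF V]
  have "?vec x \<in> ?L" if "x \<in> R" for x
    using assms that
  proof (rule R_induct)
    show "?vec (res \<beta> v) \<in> ?L" if "v \<in> set vs" for v
      using that L(2) by auto
    have "?vec (\<lambda>_. 0) = 0\<^sub>v \<beta>"
      by auto
    then show "?vec (\<lambda>_. 0) \<in> ?L"
      using additive_setD(2)[OF L(1)] by simp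
    fix y z assume "?vec y \<in> ?L" "?vec z \<in> ?L"
    then have "?vec y + ?vec z \<in> ?L"
      by (rule additive_setD(3)[OF L(1)])
    also have "?vec y + ?vec z = ?vec (\<lambda>j. y j + z j)"
      by auto
    finally show "?vec (\<lambda>j. y j + z j) \<in> ?L" .
  qed
  then have "?vec ` R \<subseteq> ?L"
    by auto
  moreover have "finite ?L"
    using additive_setD(1)[OF L(1)] finite_carrier_vec finite_subset by blast
  \<comment> \<open>Cutting off at \<beta> loses nothing, since residues vanish from there
    on.\<close>
  moreover have "inj_on ?vec R"
  proof (rule inj_onI)
    fix x y assume "x \<in> R" "y \<in> R" and eq: "?vec x = ?vec y"
    have "x j = y j" if "j < \<beta>" for j
      using arg_cong[OF eq, of "\<lambda>v. v $ j"] that by simp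
    moreover have "x j = y j" if "\<not> j < \<beta>" for j
      using \<open>x \<in> R\<close> \<open>y \<in> R\<close> that by (auto simp: R_def res_def)
    ultimately show "x = y"
      by blast
  qed
  ultimately have "card R \<le> card ?L"
    using card_inj_on_le by blast
  also have "\<dots> \<le> 5 ^ card ?V"
    using V by (intro card_lin_span_le) auto
  also have "\<dots> \<le> 5 ^ length vs"
    using card_length[of "map (\<lambda>v. ?vec (res \<beta> v)) vs"] by (intro power_increasing) auto
  finally show ?thesis .
qed

text \<open>The space whose dimension is \<kappa> in \<open>code_of_type\<close>.\<close>

definition W :: "Z5 vec set" where
  "W = fst ` {c \<in> \<C>. c [^]\<^bsub>G\<^esub> (5::nat) = \<one>\<^bsub>G\<^esub>}"

lemma W_eq: "W = fst ` {c \<in> \<C>. res \<beta> c = (\<lambda>_. 0)}"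
  unfolding W_def using pow_5_eq_one_iff[OF \<C>.mem_carrier] by (intro arg_cong[of _ _ "image fst"]) blast

lemma additive_W: "additive_set \<alpha> W"
  unfolding additive_set_def
proof (intro conjI ballI)
  show "W \<subseteq> carrier_vec \<alpha>"
    unfolding W_eq using \<C>.subset by (auto simp: carrier_mixed_group)
  show "0\<^sub>v \<alpha> \<in> W"
    unfolding W_eq using \<C>.one_closed
    by (intro image_eqI[of _ _ "\<one>\<^bsub>G\<^esub>"]) (simp_all, simp add: one_mixed_group)
  fix x y assume "x \<in> W" "y \<in> W"
  then obtain c d where *: "x = fst c" "c \<in> \<C>" "res \<beta> c = (\<lambda>_. 0)"
    "y = fst d" "d \<in> \<C>" "res \<beta> d = (\<lambda>_. 0)"
    unfolding W_eq by blast
  have "res \<beta> (c \<otimes>\<^bsub>G\<^esub> d) = (\<lambda>_. 0)"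
    using * by (simp add: res_add)
  moreover have "x + y = fst (c \<otimes>\<^bsub>G\<^esub> d)"
    using * by (simp add: mult_mixed_group)
  ultimately show "x + y \<in> W"
    unfolding W_eq using \<C>.m_closed[OF *(2,5)] by blast
qed

lemma finite_S: "finite S"
  using additive_setD(1)[OF additive_S] finite_carrier_vec finite_subset by blast

lemma card_C_le_card_S: "card \<C> \<le> card S"
  using Gray_inj_on[OF Y Y_UNIV] \<C>.subset Gray_in_S finite_S
  by (intro card_inj_on_le[of "Gray Y"]) (auto intro: inj_on_subset)

text \<open>An element of \<open>S\<close> is the Gray image of \<open>c \<otimes> T f\<close>; it is determined by the residue of \<open>c\<close>,
  the \<open>\<int>\<^sub>5\<close>-part of the difference of \<open>c\<close> and a fixed codeword with the same residue, and the
  high digits.\<close>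

lemma card_S_le: "card S \<le> card R * card W * 5 ^ \<beta>"
proof -
  define s where "s x = (SOME c. c \<in> \<C> \<and> res \<beta> c = x)" for x
  have s: "s x \<in> \<C>" "res \<beta> (s x) = x" if "x \<in> R" for x
    using that someI_ex[of "\<lambda>c. c \<in> \<C> \<and> res \<beta> c = x"] unfolding R_def s_def by auto
  define F where "F = (\<lambda>(x, w, h :: Z5 vec). Gray Y (fst (s x) + w, vec \<beta> (\<lambda>j. digits (x j) (h $ j))))"
  have "S \<subseteq> F ` (R \<times> W \<times> carrier_vec \<beta>)"
  proof
    fix p assume "p \<in> S"
    then obtain c f where p: "p = Gray Y (c \<otimes>\<^bsub>G\<^esub> T f)" and c: "c \<in> \<C>"
      unfolding Gray_image_D[symmetric] \<D>_def by blast
    define x where "x = res \<beta> c"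
    have x: "x \<in> R"
      using c by (simp add: x_def R_def)
    \<comment> \<open>c and its representative s x have the same residue, so d has residue 0 and its
      Z5 part lies in \<open>W\<close>.\<close>
    define d where "d = c \<otimes>\<^bsub>G\<^esub> inv\<^bsub>G\<^esub> (s x)"
    have d: "d \<in> \<C>"
      using c s(1)[OF x] by (simp add: d_def)
    have c_eq: "c = s x \<otimes>\<^bsub>G\<^esub> d"
      using \<C>.mem_carrier[OF c] \<C>.mem_carrier[OF s(1)[OF x]]
      unfolding d_def by (simp add: G.m_lcomm)
    have "res \<beta> d j = 0" for j
      using res_add[OF \<C>.mem_carrier[OF s(1)[OF x]] \<C>.mem_carrier[OF d]] s(2)[OF x]
      unfolding c_eq[symmetric] x_def[symmetric] by (metis add_cancel_right_right)
    then have w: "fst d \<in> W"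
      unfolding W_eq using d by (intro image_eqI[of _ _ d]) auto
    let ?h = "vec \<beta> (\<lambda>j. hi (snd (c \<otimes>\<^bsub>G\<^esub> T f) $ j))"
    \<comment> \<open>Adding T f leaves the low digits x unchanged; its effect is contained in the
      high digits ?h.\<close>
    have "c \<otimes>\<^bsub>G\<^esub> T f = (fst (s x) + fst d, vec \<beta> (\<lambda>j. digits (x j) (?h $ j)))"
    proof (rule prod_eqI)
      have "fst c = fst (s x) + fst d"
        using arg_cong[OF c_eq, of fst] by (simp add: mult_mixed_group)
      moreover have "fst c \<in> carrier_vec \<alpha>"
        using \<C>.mem_carrier[OF c] by (auto simp: carrier_mixed_group)
      ultimately show "fst (c \<otimes>\<^bsub>G\<^esub> T f) = fst (fst (s x) + fst d, vec \<beta> (\<lambda>j. digits (x j) (?h $ j)))"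
        by (simp add: mult_mixed_group tors_def)
      have "snd c \<in> carrier_vec \<beta>"
        using \<C>.mem_carrier[OF c] by (auto simp: carrier_mixed_group)
      then show "snd (c \<otimes>\<^bsub>G\<^esub> T f) = snd (fst (s x) + fst d, vec \<beta> (\<lambda>j. digits (x j) (?h $ j)))"
        by (intro eq_vecI) (auto simp: mult_mixed_group tors_def x_def res_def intro!: Z25_eqI)
    qed
    then have "p = F (x, fst d, ?h)"
      by (simp add: p F_def)
    then show "p \<in> F ` (R \<times> W \<times> carrier_vec \<beta>)"
      using x w by (intro image_eqI) auto
  qed
  moreover have fin: "finite (R \<times> W \<times> (carrier_vec \<beta> :: Z5 vec set))"
    using finite_R additive_setD(1)[OF additive_W] finite_carrier_vec
    by (intro finite_cartesian_product) (auto intro: finite_subset)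
  ultimately have "card S \<le> card (F ` (R \<times> W \<times> carrier_vec \<beta>))"
    by (intro card_mono) auto
  also have "\<dots> \<le> card (R \<times> W \<times> (carrier_vec \<beta> :: Z5 vec set))"
    using fin by (rule card_image_le)
  also have "\<dots> = card R * card W * 5 ^ \<beta>"
    by (simp add: card_cartesian_product card_carrier_vec)
  finally show ?thesis .
qed

section \<open>Generating families from a generator matrix and from the group type\<close>

lemma generator_matrix_imp_generates:
  assumes gm: "generator_matrix \<alpha> \<beta> \<gamma> \<delta> \<C> us vs"
  shows "generates us vs"
  unfolding generates_def
proof (intro conjI ballI allI impI)
  show us: "set us \<subseteq> \<C>" and vs: "set vs \<subseteq> \<C>"
    using gm by (auto simp: generator_matrix_def)
  show "u [^]\<^bsub>G\<^esub> (5 :: nat) = \<one>\<^bsub>G\<^esub>" if "u \<in> set us" for u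
  proof -
    have "u \<in> carrier G" "G.ord u = 5"
      using gm that \<C>.mem_carrier by (auto simp: generator_matrix_def)
    then show ?thesis
      using G.pow_ord_eq_1[of u] by simp
  qed
  fix A assume A: "A \<subseteq> \<C>" "set us \<subseteq> A" "set vs \<subseteq> A" "\<one>\<^bsub>G\<^esub> \<in> A"
    "\<forall>c\<in>A. \<forall>d\<in>A. c \<otimes>\<^bsub>G\<^esub> d \<in> A"
  have A_carrier: "A \<subseteq> carrier G"
    using A(1) \<C>.subset by blast
  \<comment> \<open>The exponents are nonnegative representatives, so integer powers reduce to
    natural ones, which closure under multiplication covers.\<close>
  have pow: "x [^]\<^bsub>G\<^esub> to_int_mod_ring a \<in> A" if "x \<in> A" for x and a :: "'a::nontriv mod_ring"
  proof -
    have "x [^]\<^bsub>G\<^esub> (k :: nat) \<in> A" for k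
      by (induction k) (use A(4,5) that in auto)
    moreover have "to_int_mod_ring a = int (nat (to_int_mod_ring a))"
      using to_int_bounds(1)[of a] by simp
    ultimately show ?thesis
      by (metis int_pow_int)
  qed
  have finprod: "finprod G f I \<in> A" if "finite I" "\<And>i. i \<in> I \<Longrightarrow> f i \<in> A" for f and I :: "nat set"
    using that
  proof (induction I)
    case empty
    then show ?case
      using A(4) by simp
  next
    case (insert i I)
    then have "finprod G f (insert i I) = f i \<otimes>\<^bsub>G\<^esub> finprod G f I"
      using A_carrier by (intro G.finprod_insert) auto
    then show ?case
      using insert A(5) by simp
  qed
  show "A = \<C>"
  proof
    show "\<C> \<subseteq> A"
    proof
      fix c assume "c \<in> \<C>"
      then obtain w where "c = row_combination \<alpha> \<beta> us vs w"
        using gm unfolding generator_matrix_def by blast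
      moreover have "(\<Otimes>\<^bsub>G\<^esub>i\<in>{..<length us}. us ! i [^]\<^bsub>G\<^esub> to_int_mod_ring (fst w $ i)) \<in> A"
        using A(2) by (intro finprod pow) auto
      moreover have "(\<Otimes>\<^bsub>G\<^esub>j\<in>{..<length vs}. vs ! j [^]\<^bsub>G\<^esub> to_int_mod_ring (snd w $ j)) \<in> A"
        using A(3) by (intro finprod pow) auto
      ultimately show "c \<in> A"
        using A(5) by (simp add: row_combination_def Let_def)
    qed
  qed (fact A(1))
qed

text \<open>The rank bounds concern the code alone, so a generating family is made from its type:
  the unit vectors of the standard group are transported into \<C>.\<close>

lemma iso_imp_generates:
  assumes "G\<lparr>carrier := \<C>\<rparr> \<cong> mixed_group \<gamma> \<delta>"
  obtains us vs where "generates us vs" "length us = \<gamma>" "length vs = \<delta>"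
    and "card \<C> = 5 ^ (\<gamma> + 2 * \<delta>)"
proof -
  let ?H = "mixed_group \<gamma> \<delta>"
  interpret H: comm_group ?H
    by (rule comm_group_mixed_group)
  interpret C: group "G\<lparr>carrier := \<C>\<rparr>"
    by (rule G.subgroup_imp_group[OF subgroup])
  obtain h where h: "h \<in> iso ?H (G\<lparr>carrier := \<C>\<rparr>)"
    using C.iso_sym[OF assms] unfolding is_iso_def by blast
  then have bij: "bij_betw h (carrier ?H) \<C>"
    and mult: "\<And>x y. x \<in> carrier ?H \<Longrightarrow> y \<in> carrier ?H \<Longrightarrow> h (x \<otimes>\<^bsub>?H\<^esub> y) = h x \<otimes>\<^bsub>G\<^esub> h y"
    by (auto simp: iso_def hom_def)
  interpret h: group_hom ?H "G\<lparr>carrier := \<C>\<rparr>" h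
    by unfold_locales (use h in \<open>simp add: iso_def\<close>)
  have h_one: "h \<one>\<^bsub>?H\<^esub> = \<one>\<^bsub>G\<^esub>"
    using h.hom_one by simp
  have h_C: "h x \<in> \<C>" if "x \<in> carrier ?H" for x
    using bij that by (auto simp: bij_betw_def)
  define e :: "nat \<Rightarrow> mixed_vec" where "e i = (unit_vec \<gamma> i, 0\<^sub>v \<delta>)" for i
  define e' :: "nat \<Rightarrow> mixed_vec" where "e' j = (0\<^sub>v \<gamma>, unit_vec \<delta> j)" for j
  have e: "e i \<in> carrier ?H" "e' i \<in> carrier ?H" for i
    by (auto simp: e_def e'_def carrier_mixed_group)
  define us where "us = map (\<lambda>i. h (e i)) [0..<\<gamma>]"
  define vs where "vs = map (\<lambda>j. h (e' j)) [0..<\<delta>]"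
  have "generates us vs"
    unfolding generates_def
  proof (intro conjI ballI allI impI)
    show "set us \<subseteq> \<C>" "set vs \<subseteq> \<C>"
      using h_C[OF e(1)] h_C[OF e(2)] by (auto simp: us_def vs_def)
    show "u [^]\<^bsub>G\<^esub> (5 :: nat) = \<one>\<^bsub>G\<^esub>" if u_us: "u \<in> set us" for u
    proof -
      obtain i where u: "u = h (e i)"
        using u_us by (auto simp: us_def)
      have "res \<delta> (e i) = (\<lambda>_. 0)"
        by (auto simp: res_def e_def)
      then have "e i [^]\<^bsub>?H\<^esub> (5 :: nat) = \<one>\<^bsub>?H\<^esub>"
        using pow_5_eq_one_iff[OF e(1)] by blast
      then have "u [^]\<^bsub>G\<lparr>carrier := \<C>\<rparr>\<^esub> (5 :: nat) = \<one>\<^bsub>G\<^esub>"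
        using h.hom_nat_pow[OF e(1), of i 5] h_one by (simp add: u)
      then show ?thesis
        by (simp flip: G.nat_pow_consistent)
    qed
    fix A assume A: "A \<subseteq> \<C>" "set us \<subseteq> A" "set vs \<subseteq> A" "\<one>\<^bsub>G\<^esub> \<in> A"
      "\<forall>c\<in>A. \<forall>d\<in>A. c \<otimes>\<^bsub>G\<^esub> d \<in> A"
    have h_mult: "h (x \<otimes>\<^bsub>?H\<^esub> y) \<in> A"
      if "x \<in> carrier ?H" "y \<in> carrier ?H" "h x \<in> A" "h y \<in> A" for x y
      using that mult A(5) by simp
    \<comment> \<open>The preimage of A is examined on each of the two factors separately, where it
      contains all unit vectors.\<close>
    have "{a \<in> carrier_vec \<gamma>. h (a, 0\<^sub>v \<delta>) \<in> A} = carrier_vec \<gamma>"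
    proof (rule additive_set_eq_carrier_vec)
      show "additive_set \<gamma> {a \<in> carrier_vec \<gamma>. h (a, 0\<^sub>v \<delta>) \<in> A}"
        unfolding additive_set_def
        using h_mult[of "(_, 0\<^sub>v \<delta>)" "(_, 0\<^sub>v \<delta>)"] h_one A(4)
        by (auto simp: mixed_group_simps)
      show "unit_vec \<gamma> i \<in> {a \<in> carrier_vec \<gamma>. h (a, 0\<^sub>v \<delta>) \<in> A}" if "i < \<gamma>" for i
        using A(2) that by (auto simp: us_def e_def)
    qed
    moreover have "{b \<in> carrier_vec \<delta>. h (0\<^sub>v \<gamma>, b) \<in> A} = carrier_vec \<delta>"
    proof (rule additive_set_eq_carrier_vec)
      show "additive_set \<delta> {b \<in> carrier_vec \<delta>. h (0\<^sub>v \<gamma>, b) \<in> A}"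
        unfolding additive_set_def
        using h_mult[of "(0\<^sub>v \<gamma>, _)" "(0\<^sub>v \<gamma>, _)"] h_one A(4)
        by (auto simp: mixed_group_simps)
      show "unit_vec \<delta> i \<in> {b \<in> carrier_vec \<delta>. h (0\<^sub>v \<gamma>, b) \<in> A}" if "i < \<delta>" for i
        using A(3) that by (auto simp: vs_def e'_def)
    qed
    ultimately have ab: "h (a, 0\<^sub>v \<delta>) \<in> A" "h (0\<^sub>v \<gamma>, b) \<in> A"
      if "a \<in> carrier_vec \<gamma>" "b \<in> carrier_vec \<delta>" for a b
      using that by blast+
    show "A = \<C>"
    proof
      show "\<C> \<subseteq> A"
      proof
        fix c assume "c \<in> \<C>"
        then obtain a b where c: "c = h (a, b)" "a \<in> carrier_vec \<gamma>" "b \<in> carrier_vec \<delta>"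
          using bij by (auto simp: bij_betw_def carrier_mixed_group)
        have "h ((a, 0\<^sub>v \<delta>) \<otimes>\<^bsub>?H\<^esub> (0\<^sub>v \<gamma>, b)) \<in> A"
          using c ab by (intro h_mult) (auto simp: carrier_mixed_group)
        then show "c \<in> A"
          using c by (simp add: mult_mixed_group)
      qed
    qed (fact A(1))
  qed
  moreover have "card \<C> = 5 ^ (\<gamma> + 2 * \<delta>)"
  proof -
    have "card \<C> = card (carrier ?H)"
      using bij_betw_same_card[OF bij] by simp
    also have "\<dots> = 5 ^ \<gamma> * 25 ^ \<delta>"
      by (simp add: carrier_mixed_group card_cartesian_product card_carrier_vec)
    also have "(25 :: nat) ^ \<delta> = 5 ^ (2 * \<delta>)"
      by (simp add: power_mult)
    finally show ?thesis
      by (simp add: power_add)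
  qed
  ultimately show ?thesis
    using that by (simp add: us_def vs_def)
qed

end

theorem theorem6:
  fixes \<alpha> \<beta> \<gamma> \<delta> \<kappa> :: nat
    and Y :: "Z5 vec"
    and \<C> :: "mixed_vec set"
  assumes "Y \<in> carrier_vec 5"
    and "set (list_of_vec Y) = UNIV"
    and "\<alpha> + \<beta> > 0"
    and "0 < \<delta> + \<gamma>"
    and "\<delta> + \<gamma> \<le> \<beta> + \<kappa>"
    and "\<kappa> \<le> min \<alpha> \<gamma>"
    and "code_of_type \<alpha> \<beta> \<gamma> \<delta> \<kappa> \<C>"
  shows
    "(\<forall>us vs. generator_matrix \<alpha> \<beta> \<gamma> \<delta> \<C> us vs \<longrightarrow>
        lin_span (\<alpha> + 5 * \<beta>) (Gray Y ` \<C>) =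
        lin_span (\<alpha> + 5 * \<beta>)
          ({Gray Y (us ! i) | i. i < \<gamma>} \<union>
           {Gray Y (vs ! j) | j. j < \<delta>} \<union>
           {Gray Y ((vs ! i1 \<star> vs ! i2 \<star> vs ! i3) [^]\<^bsub>mixed_group \<alpha> \<beta>\<^esub> (5::nat)) | i1 i2 i3.
              i1 \<le> i2 \<and> i2 \<le> i3 \<and> i3 < \<delta>} \<union>
           {Gray Y ((vs ! i1 \<star> vs ! i2 \<star> vs ! i3 \<star> vs ! i4) [^]\<^bsub>mixed_group \<alpha> \<beta>\<^esub> (5::nat))
              | i1 i2 i3 i4. i1 \<le> i2 \<and> i2 \<le> i3 \<and> i3 \<le> i4 \<and> i4 < \<delta>} \<union>
           {Gray Y ((vs ! i1 \<star> vs ! i2 \<star> vs ! i3 \<star> vs ! i4 \<star> vs ! i5)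
                [^]\<^bsub>mixed_group \<alpha> \<beta>\<^esub> (5::nat))
              | i1 i2 i3 i4 i5. i1 \<le> i2 \<and> i2 \<le> i3 \<and> i3 \<le> i4 \<and> i4 \<le> i5 \<and> i5 < \<delta>}))
     \<and>
     code_rank (\<alpha> + 5 * \<beta>) (Gray Y ` \<C>) \<in>
       {\<gamma> + 2 * \<delta> ..
        min (\<beta> + \<delta> + \<kappa>)
            (\<gamma> + \<delta> + ((\<delta> + 2) choose 3) + ((\<delta> + 3) choose 4) + ((\<delta> + 4) choose 5))}
     \<and>
     int (code_rank (\<alpha> + 5 * \<beta>) (Gray Y ` \<C>)) - (int \<gamma> + 2 * int \<delta>) \<in>
       {0 ..
        min (int \<beta> - (int \<gamma> - int \<kappa>) - int \<delta>)
            (int ((\<delta> + 2) choose 3) + int ((\<delta> + 3) choose 4) + int ((\<delta> + 4) choose 5)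
              - int \<delta>)}
     \<and>
     mixed_linear Y \<alpha> \<beta> (lin_span (\<alpha> + 5 * \<beta>) (Gray Y ` \<C>))"
proof -
  have type: "subgroup \<C> (mixed_group \<alpha> \<beta>)"
    "(mixed_group \<alpha> \<beta>)\<lparr>carrier := \<C>\<rparr> \<cong> mixed_group \<gamma> \<delta>"
    "\<kappa> = lin_dim \<alpha>
      (fst ` {c \<in> \<C>. c [^]\<^bsub>mixed_group \<alpha> \<beta>\<^esub> (5::nat) = \<one>\<^bsub>mixed_group \<alpha> \<beta>\<^esub>})"
    using assms(7) by (simp_all add: code_of_type_def additive_code_def)
  interpret additive_code_Gray \<alpha> \<beta> Y \<C>
    using assms(1,2) type(1) by (rule additive_code_Gray.intro)
  let ?r = "code_rank (\<alpha> + 5 * \<beta>) (Gray Y ` \<C>)"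
  let ?b = "\<gamma> + \<delta> + ((\<delta> + 2) choose 3) + ((\<delta> + 3) choose 4) + ((\<delta> + 4) choose 5)"
  obtain us vs where gen: "generates us vs" "length us = \<gamma>" "length vs = \<delta>"
    and card_C: "card \<C> = 5 ^ (\<gamma> + 2 * \<delta>)"
    using iso_imp_generates[OF type(2)] .
  have card_S: "card S = 5 ^ ?r"
    unfolding code_rank_def S_def[symmetric] by (rule card_eq_power_lin_dim[OF additive_S])
  have "(5 :: nat) ^ (\<gamma> + 2 * \<delta>) \<le> 5 ^ ?r"
    using card_C_le_card_S unfolding card_C card_S .
  then have lower: "\<gamma> + 2 * \<delta> \<le> ?r"
    by simp
  have "card W = 5 ^ \<kappa>"
    unfolding type(3) W_def[symmetric] by (rule card_eq_power_lin_dim[OF additive_W])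
  \<comment> \<open>The three factors count residues, Z5 parts in \<open>W\<close> and high
    digits.\<close>
  then have "5 ^ ?r \<le> 5 ^ \<delta> * 5 ^ \<kappa> * (5 :: nat) ^ \<beta>"
    using order_trans[OF card_S_le[unfolded card_S] mult_right_mono[OF mult_right_mono[OF card_R_le[OF gen(1)]]]] gen(3)
    by simp
  then have "(5 :: nat) ^ ?r \<le> 5 ^ (\<beta> + \<delta> + \<kappa>)"
    by (simp add: power_add ac_simps)
  then have upper1: "?r \<le> \<beta> + \<delta> + \<kappa>"
    by simp
  have gens_c: "gens us vs \<subseteq> carrier_vec (\<alpha> + 5 * \<beta>)"
    using gens_subset_S[OF gen(1)] additive_setD(1)[OF additive_S] by blast
  have "(5 :: nat) ^ ?r \<le> 5 ^ card (gens us vs)"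
    unfolding card_S[symmetric] S_eq_span_gens[OF gen(1)]
    by (rule card_lin_span_le[OF finite_gens gens_c])
  then have upper2: "?r \<le> ?b"
    using card_gens_le[of us vs] gen(2,3) by simp
  show ?thesis
  proof (intro conjI allI impI)
    fix us vs assume gm: "generator_matrix \<alpha> \<beta> \<gamma> \<delta> \<C> us vs"
    then have len: "length us = \<gamma>" "length vs = \<delta>"
      by (simp_all add: generator_matrix_def)
    note gen = generator_matrix_imp_generates[OF gm]
    show "lin_span (\<alpha> + 5 * \<beta>) (Gray Y ` \<C>) = lin_span (\<alpha> + 5 * \<beta>)
          ({Gray Y (us ! i) | i. i < \<gamma>} \<union>
           {Gray Y (vs ! j) | j. j < \<delta>} \<union>
           {Gray Y ((vs ! i1 \<star> vs ! i2 \<star> vs ! i3) [^]\<^bsub>mixed_group \<alpha> \<beta>\<^esub> (5::nat)) | i1 i2 i3.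
              i1 \<le> i2 \<and> i2 \<le> i3 \<and> i3 < \<delta>} \<union>
           {Gray Y ((vs ! i1 \<star> vs ! i2 \<star> vs ! i3 \<star> vs ! i4) [^]\<^bsub>mixed_group \<alpha> \<beta>\<^esub> (5::nat))
              | i1 i2 i3 i4. i1 \<le> i2 \<and> i2 \<le> i3 \<and> i3 \<le> i4 \<and> i4 < \<delta>} \<union>
           {Gray Y ((vs ! i1 \<star> vs ! i2 \<star> vs ! i3 \<star> vs ! i4 \<star> vs ! i5)
                [^]\<^bsub>mixed_group \<alpha> \<beta>\<^esub> (5::nat))
              | i1 i2 i3 i4 i5. i1 \<le> i2 \<and> i2 \<le> i3 \<and> i3 \<le> i4 \<and> i4 \<le> i5 \<and> i5 < \<delta>})"
      using S_eq_span_gens[OF gen] unfolding S_def gens_eq[OF gen] len .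
  next
    show "?r \<in> {\<gamma> + 2 * \<delta> .. min (\<beta> + \<delta> + \<kappa>) ?b}"
      using lower upper1 upper2 by simp
    show "int ?r - (int \<gamma> + 2 * int \<delta>) \<in> {0 .. min (int \<beta> - (int \<gamma> - int \<kappa>) - int \<delta>)
      (int ((\<delta> + 2) choose 3) + int ((\<delta> + 3) choose 4) + int ((\<delta> + 4) choose 5) - int \<delta>)}"
      \<comment> \<open>Subtracting \<gamma> + 2 \<delta> from both bounds; the integers avoid
        truncated subtraction.\<close>
      using lower upper1 upper2 unfolding atLeastAtMost_iff min.bounded_iff by linarith
    show "mixed_linear Y \<alpha> \<beta> (lin_span (\<alpha> + 5 * \<beta>) (Gray Y ` \<C>))"
      using mixed_linear_S unfolding S_def .
  qed
qed

end
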